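(* Consider a block-structured inhomogeneous spiked Wigner matrix model with variance profiles $\Delta^{(N)}$ (possibly with infinite entries) having parameters $(\bar\Delta,\rho_1,\dots,\rho_n)$. Let $\kappa\ge1$ be fixed, let $\nu$ be a probability measure on $\mathbb{R}^\kappa$ (not depending on $N$), and let $\mathcal{P}_N$ be the law of the random matrix $V\in\mathbb{R}^{N\times\kappa}$ with i.i.d. rows drawn from $\nu$. Let the signal law $\mathcal{X}_N$ be the law of $X=\frac{\beta}{\sqrt N}VV^\top$ with $V\sim\mathcal{P}_N$, for some constant $\beta>0$. Let $$\beta_* := \sqrt{\frac{1}{\lambda_1(\mathrm{diag}(\rho)^{1/2}\, \bar{\Phi}\, \mathrm{diag}(\rho)^{1/2})}},$$ where $\bar\Phi$ is the entrywise reciprocal of $\bar\Delta$. Suppose that (a) $\mathbb{E}_{x\sim\nu}[x]=0$; (b) $\|\mathrm{Cov}_{x\sim\nu}[x]\|=\|\mathbb{E}_{x\sim\nu}xx^\top\|=1$; (c) $\nu$ has bounded support. If $\beta>\beta_*$ and $D=D(N)\in\mathbb{N}$ satisfies $D(N)\to\infty$ as $N\to\infty$, then $\chi^2_{\le D(N)}(\mathbb{P}_N\mid\mathbb{Q}_N)\to\infty$ as $N\to\infty$.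
   Context: Inhomogeneous spiked Wigner matrix model: for each $N\ge1$, let $\mathcal{X}_N$ be a probability measure on real symmetric $N\times N$ matrices and $\Delta=\Delta^{(N)}\in(\mathbb{R}_{>0}\cup\{+\infty\})^{N\times N}$ symmetric (the variance profile). Let $\mathcal J=\mathcal J^{(N)}=\{(i,j):1\le i\le j\le N,\ \Delta_{ij}\ne+\infty\}$. Two probability measures on $\mathbb{R}^{\mathcal J}$ are defined: under $\mathbb{Q}_N$, $Y_{ij}\sim\mathcal N(0,\Delta_{ij})$ independently for $(i,j)\in\mathcal J$; under $\mathbb{P}_N$, first draw $X\sim\mathcal{X}_N$, then draw $Y_{ij}\sim\mathcal N(X_{ij},\Delta_{ij})$ independently for $(i,j)\in\mathcal J$. Block structure: $\Delta^{(N)}$ is block-structured with parameters $(\bar\Delta,\rho_1,\dots,\rho_n)$, where $n\ge1$ is fixed, $\rho_1,\dots,\rho_n\in(0,1]$ sum to $1$, and $\bar\Delta\in(\mathbb{R}_{>0}\cup\{+\infty\})^{n\times n}$ is symmetric, if for each $N$ there is $q=q_N:[N]\to[n]$ with $\Delta^{(N)}_{ij}=\bar\Delta_{q(i)q(j)}$ for all $i,j\in[N]$, and $|q_N^{-1}(a)|/N\to\rho_a$ as $N\to\infty$ for each $a\in[n]$. $\bar\Phi_{ab}=1/\bar\Delta_{ab}$ with the convention $1/(+\infty)=0$; $\mathrm{diag}(\rho)$ is the diagonal matrix with entries $\rho_1,\dots,\rho_n$; $\lambda_1$ is the largest eigenvalue; if $\bar\Phi=0$, $\beta_*=+\infty$.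 $\|\cdot\|$ of a matrix is the spectral norm. Low-degree $\chi^2$-divergence: with $\mathbb{R}[Y]_{\le D}$ the polynomials of degree at most $D$ in the variables $Y_{ij}$, $(i,j)\in\mathcal J$, $$\chi^2_{\le D}(\mathbb{P}\mid\mathbb{Q}):=\sup_{f\in\mathbb{R}[Y]_{\le D}\setminus\{0\}}\frac{(\mathbb{E}_{\mathbb{P}}[f(Y)])^2}{\mathbb{E}_{\mathbb{Q}}[f(Y)^2]}-1.$$ *)

theory Defs
  imports "HOL-Probability.Probability" "HOL-Library.Poly_Mapping"
begin

text \<open>A variance profile of size N is a function on pairs of indices in 1..N with values in the
  extended reals; the value infinity means that the entry is not observed. A random matrix is
  a measure on functions of index pairs (i, j).\<close>

definition observed :: "nat \<Rightarrow> (nat \<Rightarrow> nat \<Rightarrow> ereal) \<Rightarrow> (nat \<times> nat) set" where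
  "observed N \<Delta> = {(i, j). 1 \<le> i \<and> i \<le> j \<and> j \<le> N \<and> \<Delta> i j \<noteq> \<infinity>}"

text \<open>The second argument is the variance; \<^const>\<open>normal_density\<close> expects the
  standard deviation.\<close>

definition gaussian :: "real \<Rightarrow> real \<Rightarrow> real measure" where
  "gaussian \<mu> v = density lborel (\<lambda>y. ennreal (normal_density \<mu> (sqrt v) y))"

definition gaussian_obs ::
  "nat \<Rightarrow> (nat \<Rightarrow> nat \<Rightarrow> ereal) \<Rightarrow> (nat \<times> nat \<Rightarrow> real) \<Rightarrow> (nat \<times> nat \<Rightarrow> real) measure" where
  "gaussian_obs N \<Delta> X =
     PiM (observed N \<Delta>) (\<lambda>(i, j). gaussian (X (i, j)) (real_of_ereal (\<Delta> i j)))"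

definition null_law :: "nat \<Rightarrow> (nat \<Rightarrow> nat \<Rightarrow> ereal) \<Rightarrow> (nat \<times> nat \<Rightarrow> real) measure" where
  "null_law N \<Delta> = gaussian_obs N \<Delta> (\<lambda>_. 0)"

definition planted_law ::
  "nat \<Rightarrow> (nat \<Rightarrow> nat \<Rightarrow> ereal) \<Rightarrow> (nat \<times> nat \<Rightarrow> real) measure \<Rightarrow> (nat \<times> nat \<Rightarrow> real) measure" where
  "planted_law N \<Delta> \<X> = Giry_Monad.bind \<X> (gaussian_obs N \<Delta>)"

definition block_structured ::
  "(nat \<Rightarrow> nat \<Rightarrow> nat \<Rightarrow> ereal) \<Rightarrow> ereal ^ 'n ^ 'n \<Rightarrow> real ^ 'n \<Rightarrow> bool" where
  "block_structured \<Delta> \<Delta>bar \<rho> \<longleftrightarrow>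
     (\<forall>a. 0 < \<rho> $ a \<and> \<rho> $ a \<le> 1) \<and> (\<Sum>a\<in>UNIV. \<rho> $ a) = 1 \<and>
     (\<forall>a b. 0 < \<Delta>bar $ a $ b) \<and> transpose \<Delta>bar = \<Delta>bar \<and>
     (\<exists>q :: nat \<Rightarrow> nat \<Rightarrow> 'n.
        (\<forall>N\<ge>1. \<forall>i\<in>{1..N}. \<forall>j\<in>{1..N}. \<Delta> N i j = \<Delta>bar $ q N i $ q N j) \<and>
        (\<forall>a. (\<lambda>N. real (card {i \<in> {1..N}. q N i = a}) / real N) \<longlonglongrightarrow> \<rho> $ a))"

text \<open>The factor V has rows V 1, ..., V N, so that entry (i, j) of its Gram matrix is the
  inner product of V i and V j.\<close>

definition factor_law :: "(real ^ 'k) measure \<Rightarrow> nat \<Rightarrow> (nat \<Rightarrow> real ^ 'k) measure" where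
  "factor_law \<nu> N = PiM {1..N} (\<lambda>_. \<nu>)"

definition signal_law ::
  "real \<Rightarrow> (real ^ 'k) measure \<Rightarrow> nat \<Rightarrow> (nat \<times> nat \<Rightarrow> real) measure" where
  "signal_law \<beta> \<nu> N =
     distr (factor_law \<nu> N) (PiM ({1..N} \<times> {1..N}) (\<lambda>_. borel))
       (\<lambda>V. \<lambda>(i, j)\<in>{1..N} \<times> {1..N}. \<beta> / sqrt (real N) * (V i \<bullet> V j))"

text \<open>Formal polynomials: a monomial is a finitely supported exponent function and a
  polynomial is a finitely supported coefficient function on monomials.\<close>

type_synonym 'v polynomial = "('v \<Rightarrow>\<^sub>0 nat) \<Rightarrow>\<^sub>0 real"

definition polys_upto :: "'v set \<Rightarrow> nat \<Rightarrow> 'v polynomial set" where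
  "polys_upto J D =
     {f. \<forall>m \<in> Poly_Mapping.keys f.
           Poly_Mapping.keys m \<subseteq> J \<and>
           (\<Sum>p\<in>Poly_Mapping.keys m. Poly_Mapping.lookup m p) \<le> D}"

definition poly_eval :: "'v polynomial \<Rightarrow> ('v \<Rightarrow> real) \<Rightarrow> real" where
  "poly_eval f y =
     (\<Sum>m\<in>Poly_Mapping.keys f. Poly_Mapping.lookup f m *
        (\<Prod>p\<in>Poly_Mapping.keys m. y p ^ Poly_Mapping.lookup m p))"

text \<open>Extended real valued, so that the supremum is the true one even if it is infinite. Under
  the null law the denominator is positive for every nonzero polynomial.\<close>

definition chi2_lowdeg ::
  "'v set \<Rightarrow> nat \<Rightarrow> ('v \<Rightarrow> real) measure \<Rightarrow> ('v \<Rightarrow> real) measure \<Rightarrow> ereal" where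
  "chi2_lowdeg J D P Q =
     (SUP f \<in> polys_upto J D - {0}.
        ereal ((\<integral>y. poly_eval f y \<partial>P)\<^sup>2 / (\<integral>y. (poly_eval f y)\<^sup>2 \<partial>Q))) - 1"

definition lambda_max :: "real ^ 'n ^ 'n \<Rightarrow> real" where
  "lambda_max A = Max {l. \<exists>v. v \<noteq> 0 \<and> A *v v = l *\<^sub>R v}"

definition diag :: "real ^ 'n \<Rightarrow> real ^ 'n ^ 'n" where
  "diag v = (\<chi> a b. if a = b then v $ a else 0)"

definition reciprocal :: "ereal ^ 'n ^ 'n \<Rightarrow> real ^ 'n ^ 'n" where
  "reciprocal \<Delta>bar = (\<chi> a b. real_of_ereal (1 / \<Delta>bar $ a $ b))"

definition beta_star :: "ereal ^ 'n ^ 'n \<Rightarrow> real ^ 'n \<Rightarrow> ereal" where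
  "beta_star \<Delta>bar \<rho> =
     (let \<Phi> = reciprocal \<Delta>bar; S = diag (\<chi> a. sqrt (\<rho> $ a))
      in if \<Phi> = 0 then \<infinity> else ereal (sqrt (1 / lambda_max (S ** \<Phi> ** S))))"

definition outer :: "real ^ 'k \<Rightarrow> real ^ 'k \<Rightarrow> real ^ 'k ^ 'k" where
  "outer x y = (\<chi> a b. x $ a * y $ b)"

definition mean :: "(real ^ 'k) measure \<Rightarrow> real ^ 'k" where
  "mean \<nu> = (\<integral>x. x \<partial>\<nu>)"

definition second_moment :: "(real ^ 'k) measure \<Rightarrow> real ^ 'k ^ 'k" where
  "second_moment \<nu> = (\<integral>x. outer x x \<partial>\<nu>)"

definition cov :: "(real ^ 'k) measure \<Rightarrow> real ^ 'k ^ 'k" where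
  "cov \<nu> = (\<integral>x. outer (x - mean \<nu>) (x - mean \<nu>) \<partial>\<nu>)"

definition spectral_norm :: "real ^ 'k ^ 'k \<Rightarrow> real" where
  "spectral_norm A = onorm ((*v) A)"

definition support :: "'a::topological_space measure \<Rightarrow> 'a set" where
  "support \<nu> = {x. \<forall>U. open U \<and> x \<in> U \<longrightarrow> 0 < emeasure \<nu> U}"

end

theory Submission
  imports Defs "HOL-Real_Asymp.Real_Asymp"
begin

text \<open>
  Fix an even length \<open>L\<close> and test with the weighted count of \<open>L\<close>-cycles,
  \<open>f(Y) = (\<Sum>E. \<Prod>e\<in>E. Y e / \<Delta> e)\<close>, where \<open>E\<close> runs over the edge sets of \<open>L\<close>-cycles of observed
  entries. Distinct cycles are orthogonal under the null law, so the second moment of \<open>f\<close> is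
  \<open>S = (\<Sum>E. \<Prod>e\<in>E. 1 / \<Delta> e)\<close>, while its planted mean is \<open>(\<beta> / \<surd>N)^L tr(\<Sigma>^L) S\<close> with \<open>\<Sigma>\<close> the
  second moment matrix of \<open>\<nu>\<close>. Every cycle arises from at most \<open>2 L\<close> injective closed walks, and
  almost all closed walks are injective, so \<open>2 L S / N^L\<close> is asymptotically at least
  \<open>tr(T^L)\<close> for \<open>T = diag(\<rho>)^(1/2) \<Phi> diag(\<rho>)^(1/2)\<close>. For even \<open>L\<close> we have \<open>tr(\<Sigma>^L) \<ge> 1\<close> and
  \<open>tr(T^L) \<ge> \<lambda>^L\<close> with \<open>\<lambda>\<close> the top eigenvalue of \<open>T\<close>. The ratio is therefore eventually at least
  \<open>(\<beta>^2 \<lambda>)^L / (4 L)\<close>, which is unbounded in \<open>L\<close> since \<open>\<beta>^2 \<lambda> > 1\<close>; a fixed large \<open>L\<close> suffices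
  for each bound.
\<close>

section \<open>Closed walks and powers of symmetric matrices\<close>

primrec mpow :: "real ^ 'n ^ 'n \<Rightarrow> nat \<Rightarrow> real ^ 'n ^ 'n" where
  "mpow A 0 = mat 1"
| "mpow A (Suc k) = mpow A k ** A"

lemma mpow_add: "mpow A (j + k) = mpow A j ** mpow A k"
  by (induction k) (simp_all add: matrix_mul_assoc)

lemma mpow_vec: "mpow A k *v v = ((*v) A ^^ k) v"
  by (induction k arbitrary: v)
     (simp_all add: funpow_swap1 matrix_vector_mul_assoc[symmetric])

lemma transpose_mpow:
  assumes "transpose A = A"
  shows "transpose (mpow A k) = mpow A k"
proof (induction k)
  case (Suc k)
  have "A ** mpow A k = mpow A k ** A"
    using mpow_add[of A 1 k] mpow_add[of A k 1] by simp
  then show ?case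
    using Suc assms by (simp add: matrix_transpose_mul)
qed simp

text \<open>Expanding \<open>mpow A k\<close> entrywise yields one term for each walk with
  \<open>k\<close> steps. The endpoint weight \<open>F\<close> makes the induction work: the last
  step is absorbed into \<open>F\<close> before the induction hypothesis applies. Choosing
  \<open>F a b\<close> as the entry from \<open>b\<close> back to \<open>a\<close> later closes the
  walk.\<close>

lemma sum_PiE_walk:
  fixes F :: "'n::finite \<Rightarrow> 'n \<Rightarrow> real"
  shows "(\<Sum>c\<in>{..k} \<rightarrow>\<^sub>E UNIV. F (c 0) (c k) * (\<Prod>i<k. A $ c i $ c (Suc i))) =
    (\<Sum>a\<in>UNIV. \<Sum>b\<in>UNIV. F a b * mpow A k $ a $ b)"
proof (induction k arbitrary: F)
  case 0
  have eq: "{0::nat} \<rightarrow>\<^sub>E (UNIV::'n set) = range (\<lambda>a. (\<lambda>_. undefined)(0 := a))"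
  proof (intro equalityI subsetI)
    fix c :: "nat \<Rightarrow> 'n" assume "c \<in> {0} \<rightarrow>\<^sub>E UNIV"
    then have "c = (\<lambda>_. undefined)(0 := c 0)" by (auto simp: PiE_def extensional_def fun_eq_iff)
    then show "c \<in> range (\<lambda>a. (\<lambda>_. undefined)(0 := a))" by (rule range_eqI)
  qed (auto simp: PiE_def extensional_def)
  have "inj (\<lambda>a. (\<lambda>_. undefined)(0 := a) :: nat \<Rightarrow> 'n)"
    by (auto simp: inj_def fun_eq_iff)
  then show ?case
    by (simp add: eq sum.reindex mat_def if_distrib sum.If_cases
        cong: if_cong)
next
  case (Suc k)
  have eq: "{..Suc k} \<rightarrow>\<^sub>E (UNIV::'n set) =
      (\<lambda>(y, g). g(Suc k := y)) ` (UNIV \<times> ({..k} \<rightarrow>\<^sub>E UNIV))"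
    unfolding atMost_Suc by (rule PiE_insert_eq)
  have inj: "inj_on (\<lambda>(y, g). g(Suc k := y)) (UNIV \<times> ({..k} \<rightarrow>\<^sub>E (UNIV::'n set)))"
    by (rule inj_combinator) simp
  have "(\<Sum>c\<in>{..Suc k} \<rightarrow>\<^sub>E UNIV. F (c 0) (c (Suc k)) * (\<Prod>i<Suc k. A $ c i $ c (Suc i))) =
      (\<Sum>(y,g)\<in>UNIV \<times> ({..k} \<rightarrow>\<^sub>E UNIV). F (g 0) y * ((\<Prod>i<k. A $ g i $ g (Suc i)) * A $ g k $ y))"
    unfolding eq sum.reindex[OF inj] by (intro sum.cong) auto
  also have "\<dots> = (\<Sum>g\<in>{..k} \<rightarrow>\<^sub>E UNIV. \<Sum>y\<in>UNIV. F (g 0) y * ((\<Prod>i<k. A $ g i $ g (Suc i)) * A $ g k $ y))"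
    unfolding sum.cartesian_product[symmetric] by (rule sum.swap)
  also have "\<dots> = (\<Sum>g\<in>{..k} \<rightarrow>\<^sub>E UNIV. (\<Sum>y\<in>UNIV. F (g 0) y * A $ g k $ y) * (\<Prod>i<k. A $ g i $ g (Suc i)))"
    by (intro sum.cong) (simp_all add: sum_distrib_right sum_distrib_left mult_ac)
  also have "\<dots> = (\<Sum>a\<in>UNIV. \<Sum>x\<in>UNIV. (\<Sum>y\<in>UNIV. F a y * A $ x $ y) * mpow A k $ a $ x)"
    by (rule Suc.IH)
  also have "\<dots> = (\<Sum>a\<in>UNIV. \<Sum>y\<in>UNIV. F a y * mpow A (Suc k) $ a $ y)"
  proof (rule sum.cong[OF refl])
    fix a
    have "(\<Sum>x\<in>UNIV. (\<Sum>y\<in>UNIV. F a y * A $ x $ y) * mpow A k $ a $ x) =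
      (\<Sum>x\<in>UNIV. \<Sum>y\<in>UNIV. F a y * (mpow A k $ a $ x * A $ x $ y))"
      by (simp add: sum_distrib_right sum_distrib_left mult_ac)
    also have "\<dots> = (\<Sum>y\<in>UNIV. \<Sum>x\<in>UNIV. F a y * (mpow A k $ a $ x * A $ x $ y))"
      by (rule sum.swap)
    also have "\<dots> = (\<Sum>y\<in>UNIV. F a y * mpow A (Suc k) $ a $ y)"
      by (simp add: matrix_matrix_mult_def sum_distrib_left)
    finally show "(\<Sum>x\<in>UNIV. (\<Sum>y\<in>UNIV. F a y * A $ x $ y) * mpow A k $ a $ x) =
      (\<Sum>y\<in>UNIV. F a y * mpow A (Suc k) $ a $ y)" .
  qed
  finally show ?case .
qed

text \<open>This is the trace of the \<open>L\<close>-th power of \<phi>, written as a sum over all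
  closed walks, including those that revisit vertices. The vertices will be coordinates of a row,
  blocks, or the indices \<open>{1..N}\<close>.\<close>

definition cycle_sum :: "nat \<Rightarrow> ('a \<Rightarrow> 'a \<Rightarrow> real) \<Rightarrow> 'a set \<Rightarrow> real" where
  "cycle_sum L \<phi> T = (\<Sum>c\<in>{..<L} \<rightarrow>\<^sub>E T. \<Prod>i<L. \<phi> (c i) (c (Suc i mod L)))"

lemma cycle_sum_eq_trace:
  "cycle_sum (Suc k) (\<lambda>a b. A $ a $ b) UNIV = trace (mpow A (Suc k))"
proof -
  have "cycle_sum (Suc k) (\<lambda>a b. A $ a $ b) UNIV =
      (\<Sum>c\<in>{..k} \<rightarrow>\<^sub>E UNIV. A $ c k $ c 0 * (\<Prod>i<k. A $ c i $ c (Suc i)))"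
    unfolding cycle_sum_def lessThan_Suc_atMost
    by (intro sum.cong refl) (simp add: lessThan_Suc_atMost[symmetric])
  also have "\<dots> = (\<Sum>a\<in>UNIV. \<Sum>b\<in>UNIV. A $ b $ a * mpow A k $ a $ b)"
    by (rule sum_PiE_walk)
  also have "\<dots> = trace (mpow A (Suc k))"
    by (simp add: trace_def matrix_matrix_mult_def mult.commute)
  finally show ?thesis .
qed

text \<open>The Frobenius norm dominates the spectral norm, by the Cauchy-Schwarz inequality in each
  row.\<close>

lemma power2_norm_matrix_vector_mult_le:
  fixes P :: "real ^ 'n ^ 'm"
  shows "(norm (P *v v))\<^sup>2 \<le> (\<Sum>a\<in>UNIV. \<Sum>b\<in>UNIV. (P $ a $ b)\<^sup>2) * (norm v)\<^sup>2"
proof -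
  have "(norm (P *v v))\<^sup>2 = (\<Sum>a\<in>UNIV. (\<Sum>b\<in>UNIV. P $ a $ b * v $ b)\<^sup>2)"
    by (simp add: norm_vec_def L2_set_def sum_nonneg matrix_vector_mult_def)
  also have "\<dots> \<le> (\<Sum>a\<in>UNIV. (\<Sum>b\<in>UNIV. (P $ a $ b)\<^sup>2) * (\<Sum>b\<in>UNIV. (v $ b)\<^sup>2))"
    by (intro sum_mono Cauchy_Schwarz_ineq_sum)
  also have "\<dots> = (\<Sum>a\<in>UNIV. \<Sum>b\<in>UNIV. (P $ a $ b)\<^sup>2) * (norm v)\<^sup>2"
    by (simp add: norm_vec_def L2_set_def sum_nonneg sum_distrib_right)
  finally show ?thesis .
qed

text \<open>For symmetric \<open>A\<close> the sequence \<open>norm (A^k v)\<close> is log-convex, so its first growth ratio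
  is a lower bound for all of them.\<close>

lemma norm_funpow_symmetric_ge:
  fixes A :: "real ^ 'n ^ 'n"
  assumes sym: "transpose A = A" and r: "0 \<le> r" and v: "r * norm v \<le> norm (A *v v)"
  shows "r ^ k * norm v \<le> norm (((*v) A ^^ k) v)"
proof -
  define a where "a k = norm (((*v) A ^^ k) v)" for k
  have adj: "(A *v x) \<bullet> y = x \<bullet> (A *v y)" for x y
    by (metis dot_lmul_matrix sym vector_transpose_matrix)
  have convex: "(a (Suc k))\<^sup>2 \<le> a k * a (Suc (Suc k))" for k
  proof -
    have "(a (Suc k))\<^sup>2 = ((*v) A ^^ k) v \<bullet> ((*v) A ^^ Suc (Suc k)) v"
      by (simp add: a_def power2_norm_eq_inner adj)
    also have "\<dots> \<le> a k * a (Suc (Suc k))"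
      unfolding a_def by (rule norm_cauchy_schwarz)
    finally show ?thesis .
  qed
  have step: "r * a k \<le> a (Suc k)" for k
  proof (induction k)
    case 0
    then show ?case using v by (simp add: a_def)
  next
    case (Suc k)
    show ?case
    proof (cases "a (Suc k) = 0")
      case False
      then have pos: "0 < a (Suc k)" by (simp add: a_def)
      have "a k \<noteq> 0"
        using convex[of k] pos by auto
      then have "0 < a k" by (simp add: a_def)
      have "a k * (r * a (Suc k)) = (r * a k) * a (Suc k)" by simp
      also have "\<dots> \<le> (a (Suc k))\<^sup>2"
        using Suc pos by (simp add: power2_eq_square)
      also have "\<dots> \<le> a k * a (Suc (Suc k))" by (rule convex)
      finally show ?thesis using \<open>0 < a k\<close> by simp
    qed (simp add: a_def)
  qed
  have "r ^ k * a 0 \<le> a k"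
  proof (induction k)
    case (Suc k)
    have "r ^ Suc k * a 0 \<le> r * a k"
      using mult_left_mono[OF Suc r] by (simp add: mult_ac)
    then show ?case using step[of k] by simp
  qed simp
  then show ?thesis by (simp add: a_def)
qed

text \<open>With \<open>P = mpow A m\<close> symmetric, the trace of \<open>P ** P\<close> is the
  squared Frobenius norm of \<open>P\<close>, hence bounds the stretch of the single vector
  \<open>v\<close>. Even length makes the trace a sum of squares, so eigenvalues of opposite sign
  cannot cancel.\<close>

lemma cycle_sum_even_ge:
  fixes A :: "real ^ 'n ^ 'n"
  assumes sym: "transpose A = A" and r: "0 \<le> r" and v: "v \<noteq> 0" "r * norm v \<le> norm (A *v v)"
    and m: "0 < m"
  shows "r ^ (2 * m) \<le> cycle_sum (2 * m) (\<lambda>a b. A $ a $ b) UNIV"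
proof -
  define P where "P = mpow A m"
  have symP: "P $ a $ b = P $ b $ a" for a b
    using transpose_mpow[OF sym, of m] unfolding P_def transpose_def
    by (metis vec_lambda_beta)
  have "(r ^ m * norm v)\<^sup>2 \<le> (norm (P *v v))\<^sup>2"
    unfolding P_def mpow_vec using r norm_funpow_symmetric_ge[OF sym r v(2)]
    by (intro power_mono) auto
  also have "\<dots> \<le> (\<Sum>a\<in>UNIV. \<Sum>b\<in>UNIV. (P $ a $ b)\<^sup>2) * (norm v)\<^sup>2"
    by (rule power2_norm_matrix_vector_mult_le)
  finally have "r ^ (2 * m) \<le> (\<Sum>a\<in>UNIV. \<Sum>b\<in>UNIV. (P $ a $ b)\<^sup>2)"
    using v(1) by (simp add: power_mult_distrib power_even_eq)
  also have "\<dots> = (\<Sum>a\<in>UNIV. \<Sum>b\<in>UNIV. P $ a $ b * P $ b $ a)"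
    unfolding power2_eq_square by (subst (2) symP) (rule refl)
  also have "\<dots> = trace (mpow A (2 * m))"
    by (simp add: trace_def matrix_matrix_mult_def P_def mult_2 mpow_add)
  also have "\<dots> = cycle_sum (2 * m) (\<lambda>a b. A $ a $ b) UNIV"
    using cycle_sum_eq_trace[of "2 * m - 1" A] m by simp
  finally show ?thesis .
qed

section \<open>Spectral norm and largest eigenvalue\<close>

text \<open>The spectral norm is the least bound on the stretch, so any smaller \<open>r\<close>
  fails at some vector. That vector is the input to \<open>cycle_sum_even_ge\<close>.\<close>

lemma ex_norm_matrix_vector_mult_ge:
  fixes A :: "real ^ 'n ^ 'n"
  assumes "r < spectral_norm A"
  obtains v where "v \<noteq> 0" "r * norm v \<le> norm (A *v v)"
proof -
  have "\<not> (\<forall>v. norm (A *v v) \<le> r * norm v)"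
    using onorm_le[of "(*v) A" r] assms unfolding spectral_norm_def by auto
  then obtain v where v: "r * norm v < norm (A *v v)" by (auto simp: not_le)
  then have "v \<noteq> 0" by auto
  with v show ?thesis using that by force
qed

text \<open>Eigenvectors of distinct eigenvalues are orthogonal, hence independent, and the
  dimension is finite. The \<open>Max\<close> in \<open>lambda_max\<close> is meaningful only for a
  finite set.\<close>

lemma finite_eigenvalues_symmetric:
  fixes A :: "real ^ 'n ^ 'n"
  assumes sym: "transpose A = A"
  shows "finite {l. \<exists>v. v \<noteq> 0 \<and> A *v v = l *\<^sub>R v}" (is "finite ?E")
proof -
  have adj: "(A *v x) \<bullet> y = x \<bullet> (A *v y)" for x y
    by (metis dot_lmul_matrix sym vector_transpose_matrix)
  obtain e where e: "\<And>l. l \<in> ?E \<Longrightarrow> e l \<noteq> 0 \<and> A *v e l = l *\<^sub>R e l"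
  proof -
    have "\<forall>l\<in>?E. \<exists>v. v \<noteq> 0 \<and> A *v v = l *\<^sub>R v" by simp
    then show ?thesis using that unfolding bchoice_iff by blast
  qed
  have orth: "e l \<bullet> e k = 0" if "l \<in> ?E" "k \<in> ?E" "l \<noteq> k" for l k
    using adj[of "e l" "e k"] e[OF that(1)] e[OF that(2)] that(3) by auto
  then have inj: "inj_on e ?E"
  proof (intro inj_onI)
    fix l k assume lk: "l \<in> ?E" "k \<in> ?E" "e l = e k"
    have "e l \<bullet> e l \<noteq> 0" using e[OF lk(1)] by simp
    with orth[OF lk(1,2)] lk(3) show "l = k" by auto
  qed
  have "independent (e ` ?E)"
  proof (rule pairwise_orthogonal_independent)
    show "pairwise orthogonal (e ` ?E)"
    proof (intro pairwiseI)
      fix x y assume "x \<in> e ` ?E" "y \<in> e ` ?E" "x \<noteq> y"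
      then obtain l k where lk: "l \<in> ?E" "k \<in> ?E" "x = e l" "y = e k" by (elim imageE)
      with \<open>x \<noteq> y\<close> have "l \<noteq> k" by auto
      with orth[OF lk(1,2)] lk(3,4) show "orthogonal x y" by (simp add: orthogonal_def)
    qed
    show "0 \<notin> e ` ?E"
    proof
      assume "0 \<in> e ` ?E"
      then obtain l where l: "0 = e l" "l \<in> ?E" by (rule imageE)
      then show False using e[OF l(2)] by simp
    qed
  qed
  then have "finite (e ` ?E)"
    by (rule independent_imp_finite)
  then show ?thesis using inj by (rule finite_imageD)
qed

text \<open>The maximum of the Rayleigh quotient is an eigenvalue, so the set whose maximum defines
  \<^const>\<open>lambda_max\<close> is not empty.\<close>

lemma ex_eigenvector_lambda_max:
  fixes A :: "real ^ 'n ^ 'n"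
  assumes sym: "transpose A = A"
  obtains v where "v \<noteq> 0" "A *v v = lambda_max A *\<^sub>R v"
    and "\<And>w. w \<bullet> (A *v w) \<le> lambda_max A * (w \<bullet> w)"
proof -
  have adj: "(A *v x) \<bullet> y = x \<bullet> (A *v y)" for x y
    by (metis dot_lmul_matrix sym vector_transpose_matrix)
  let ?E = "{l. \<exists>v. v \<noteq> 0 \<and> A *v v = l *\<^sub>R v}"
  have "continuous_on (sphere 0 1) (\<lambda>v. v \<bullet> (A *v v))"
    by (intro continuous_intros linear_continuous_on matrix_vector_mul_bounded_linear)
  moreover have "sphere 0 1 \<noteq> ({} :: (real ^ 'n) set)" by simp
  ultimately obtain u where u: "norm u = 1" "\<And>w. norm w = 1 \<Longrightarrow> w \<bullet> (A *v w) \<le> u \<bullet> (A *v u)"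
    using continuous_attains_sup[of "sphere 0 1 :: (real ^ 'n) set" "\<lambda>v. v \<bullet> (A *v v)"] by auto
  define \<mu> where "\<mu> = u \<bullet> (A *v u)"
  have ray: "w \<bullet> (A *v w) \<le> \<mu> * (w \<bullet> w)" for w
  proof (cases "w = 0")
    case False
    have "(w /\<^sub>R norm w) \<bullet> (A *v (w /\<^sub>R norm w)) \<le> \<mu>"
      unfolding \<mu>_def using False by (intro u) simp
    then have "(w \<bullet> (A *v w)) / (norm w)\<^sup>2 \<le> \<mu>"
      by (simp add: matrix_vector_mult_scaleR divide_simps power2_eq_square split: if_splits)
    with False show ?thesis
      by (simp add: power2_norm_eq_inner[symmetric] divide_simps split: if_splits)
  qed simp
  \<comment> \<open>\<open>B\<close> is positive semidefinite and its quadratic form vanishes at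
    \<open>u\<close>. Perturbing \<open>u\<close> in the direction \<open>B u\<close> then forces
    \<open>B u = 0\<close>, which is the eigenvector equation.\<close>
  define B where "B x = \<mu> *\<^sub>R x - A *v x" for x
  have B_add: "B (x + y) = B x + B y" and B_scale: "B (t *\<^sub>R x) = t *\<^sub>R B x" for x y t
    by (simp_all add: B_def matrix_vector_right_distrib matrix_vector_mult_scaleR algebra_simps)
  have B_adj: "B x \<bullet> y = x \<bullet> B y" for x y
    by (simp add: B_def inner_diff_left inner_diff_right adj)
  have B_nonneg: "0 \<le> w \<bullet> B w" for w
    using ray[of w] by (simp add: B_def inner_diff_right)
  have "u \<bullet> B u = 0"
    using u(1) by (simp add: B_def inner_diff_right \<mu>_def power2_norm_eq_inner[symmetric])
  have quad: "0 \<le> 2 * t * (B u \<bullet> B u) + t\<^sup>2 * (B u \<bullet> B (B u))" for t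
  proof -
    have "0 \<le> (u + t *\<^sub>R B u) \<bullet> B (u + t *\<^sub>R B u)" by (rule B_nonneg)
    also have "\<dots> = 2 * t * (B u \<bullet> B u) + t\<^sup>2 * (B u \<bullet> B (B u))"
      using \<open>u \<bullet> B u = 0\<close> B_adj[of u "B u"]
      by (simp add: B_add B_scale inner_add_left inner_add_right power2_eq_square algebra_simps)
    finally show ?thesis .
  qed
  have "B u = 0"
  proof (rule ccontr)
    assume "B u \<noteq> 0"
    define p where "p = B u \<bullet> B u"
    define q where "q = B u \<bullet> B (B u)"
    have p: "0 < p" using \<open>B u \<noteq> 0\<close> by (simp add: p_def)
    have q: "0 \<le> q" unfolding q_def by (rule B_nonneg)
    \<comment> \<open>Close to the minimiser \<open>- p / q\<close> of the quadratic, with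
      \<open>q + 1\<close> in place of \<open>q\<close> so that \<open>q = 0\<close> is
      covered.\<close>
    define t where "t = - p / (q + 1)"
    have "2 * t * p + t\<^sup>2 * q = - (p\<^sup>2 * (q + 2)) / (q + 1)\<^sup>2"
      using q by (simp add: t_def power2_eq_square divide_simps) (simp add: algebra_simps)
    also have "\<dots> < 0" using p q by (simp add: divide_simps)
    finally show False using quad[of t] by (simp add: p_def q_def)
  qed
  then have eig: "A *v u = \<mu> *\<^sub>R u" by (simp add: B_def)
  have u0: "u \<noteq> 0" using u(1) by auto
  have "lambda_max A = \<mu>"
    unfolding lambda_max_def
  proof (rule Max_eqI)
    show "finite ?E" by (rule finite_eigenvalues_symmetric[OF sym])
    show "\<mu> \<in> ?E" using eig u0 by auto
    fix l assume "l \<in> ?E"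
    then obtain v where v: "v \<noteq> 0" "A *v v = l *\<^sub>R v" by auto
    with ray[of v] show "l \<le> \<mu>" by simp
  qed
  with u0 eig ray show ?thesis using that by simp
qed

section \<open>Cycles in the complete graph\<close>

lemma prod_Suc_mod:
  fixes g :: "nat \<Rightarrow> 'a::comm_monoid_mult"
  shows "(\<Prod>i<L. g (Suc i mod L)) = (\<Prod>i<L. g i)"
proof (cases L)
  case (Suc k)
  have "(\<Prod>i<Suc k. g (Suc i mod Suc k)) = (\<Prod>i<k. g (Suc i)) * g 0"
    by simp
  then show ?thesis
    unfolding Suc prod.lessThan_Suc_shift by (simp add: mult.commute)
qed simp

text \<open>Undirected edges are stored with the smaller endpoint first, to match the upper
  triangular index set \<open>observed\<close>.\<close>

definition edge :: "nat \<Rightarrow> nat \<Rightarrow> nat \<times> nat" where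
  "edge a b = (min a b, max a b)"

lemma edge_eq_iff: "edge a b = edge c d \<longleftrightarrow> a = c \<and> b = d \<or> a = d \<and> b = c"
  by (auto simp: edge_def min_def max_def split: if_splits)

definition cycle_edge :: "nat \<Rightarrow> (nat \<Rightarrow> nat) \<Rightarrow> nat \<Rightarrow> nat \<times> nat" where
  "cycle_edge L w i = edge (w i) (w (Suc i mod L))"

definition cycles :: "nat \<Rightarrow> nat set \<Rightarrow> (nat \<Rightarrow> nat) set" where
  "cycles L T = {w \<in> {..<L} \<rightarrow>\<^sub>E T. inj_on w {..<L}}"

lemma finite_cycles: "finite T \<Longrightarrow> finite (cycles L T)"
  unfolding cycles_def by (rule finite_subset[OF _ finite_PiE[of "{..<L}" "\<lambda>_. T"]]) auto

text \<open>Wrapping around only reaches the residue 0, which is not a successor.\<close>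

lemma Suc_mod_eq_Suc_iff:
  assumes "i < L" "Suc k < L"
  shows "Suc i mod L = Suc k \<longleftrightarrow> i = k"
proof (cases "Suc i = L")
  case False
  then have "Suc i < L" using assms by simp
  then show ?thesis by simp
qed (use assms in auto)

text \<open>Equal edges at distinct positions would be traversed in opposite directions, making each
  position the cyclic successor of the other. Then \<open>i = (i + 2) mod L\<close>, which is
  impossible for \<open>3 \<le> L\<close>.\<close>

lemma inj_on_cycle_edge:
  assumes L: "3 \<le> L" and w: "inj_on w {..<L}"
  shows "inj_on (cycle_edge L w) {..<L}"
proof (rule inj_onI)
  fix i j assume ij: "i \<in> {..<L}" "j \<in> {..<L}" and eq: "cycle_edge L w i = cycle_edge L w j"
  have s: "Suc i mod L \<in> {..<L}" "Suc j mod L \<in> {..<L}" using L by auto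
  show "i = j"
  proof (rule ccontr)
    assume "i \<noteq> j"
    with eq w ij have "w i = w (Suc j mod L)" "w (Suc i mod L) = w j"
      unfolding cycle_edge_def edge_eq_iff by (auto dest: inj_onD)
    with w ij s have *: "i = Suc j mod L" "j = Suc i mod L"
      by (auto dest: inj_onD)
    then have "i = Suc (Suc i mod L) mod L" by simp
    also have "\<dots> = (i + 2) mod L" by (simp add: mod_Suc_eq)
    finally have "i = (i + 2) mod L" .
    moreover have "i + 2 < L \<Longrightarrow> (i + 2) mod L = i + 2" by simp
    moreover have "\<not> i + 2 < L \<Longrightarrow> (i + 2) mod L = i + 2 - L"
      using ij L by (simp add: le_mod_geq)
    ultimately show False using L ij by (cases "i + 2 < L") auto
  qed
qed

text \<open>A cycle is traversed from its edge set by specifying the first two vertices: every later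
  vertex is the neighbour of its predecessor that was not visited just before.\<close>

lemma cycle_edges_determine_cycle:
  assumes w: "inj_on w {..<L}" and w': "inj_on w' {..<L}"
    and eq: "cycle_edge L w ` {..<L} = cycle_edge L w' ` {..<L}"
    and start: "w 0 = w' 0" "w 1 = w' 1"
  shows "Suc k < L \<Longrightarrow> w k = w' k \<and> w (Suc k) = w' (Suc k)"
proof (induction k)
  case 0
  then show ?case using start by simp
next
  case (Suc k)
  then have IH: "w k = w' k" "w (Suc k) = w' (Suc k)" by simp_all
  have "cycle_edge L w (Suc k) \<in> cycle_edge L w' ` {..<L}"
    using Suc.prems eq by auto
  then obtain i where i: "i < L" "cycle_edge L w (Suc k) = cycle_edge L w' i" by auto
  have s: "Suc i mod L < L" using i by simp
  from i(2) Suc.prems consider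
    "w (Suc k) = w' i" "w (Suc (Suc k)) = w' (Suc i mod L)" |
    "w (Suc k) = w' (Suc i mod L)" "w (Suc (Suc k)) = w' i"
    by (auto simp: cycle_edge_def edge_eq_iff)
  then show ?case
  proof cases
    case 1
    then have "i = Suc k"
      using IH w' i Suc.prems by (auto dest: inj_onD)
    with 1 IH Suc.prems show ?thesis by simp
  next
    \<comment> \<open>Here \<open>w'\<close> runs through the edge in the opposite direction. It
      must be the edge just traversed, so \<open>w\<close> would step back to \<open>w k\<close>,
      against injectivity.\<close>
    case 2
    then have "Suc i mod L = Suc k"
      using IH w' s Suc.prems by (auto dest: inj_onD)
    then have "i = k"
      using Suc_mod_eq_Suc_iff[of i L k] i Suc.prems by simp
    with 2 IH have "w (Suc (Suc k)) = w k" by simp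
    then have False using w Suc.prems by (auto dest: inj_onD)
    then show ?thesis ..
  qed
qed

text \<open>Given the edge set, a marked cycle is determined by its first directed edge. At most
  \<open>L\<close> edges with two orientations each leave \<open>2 * L\<close> choices;
  \<open>?B\<close> collects both orientations because \<open>edge\<close> keeps only one.\<close>

lemma card_cycles_with_edges_le:
  assumes L: "3 \<le> L"
  shows "card {w \<in> cycles L T. cycle_edge L w ` {..<L} = E} \<le> 2 * L"
proof (cases "{w \<in> cycles L T. cycle_edge L w ` {..<L} = E} = {}")
  case False
  let ?W = "{w \<in> cycles L T. cycle_edge L w ` {..<L} = E}"
  let ?B = "E \<union> prod.swap ` E"
  from False have E: "finite E" "card E \<le> L"
    using card_image_le[of "{..<L}"] by auto
  have inj: "inj_on (\<lambda>w. (w 0, w 1)) ?W"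
  proof (rule inj_onI)
    fix w w' assume ww: "w \<in> ?W" "w' \<in> ?W" and eq: "(w 0, w 1) = (w' 0, w' 1)"
    have *: "Suc k < L \<Longrightarrow> w k = w' k \<and> w (Suc k) = w' (Suc k)" for k
      using ww eq by (intro cycle_edges_determine_cycle) (auto simp: cycles_def)
    have "w k = w' k" if "k < L" for k
      using that eq *[of "k - 1"] by (cases k) auto
    with ww show "w = w'"
      by (intro PiE_ext[of w "{..<L}" "\<lambda>_. T" w']) (auto simp: cycles_def)
  qed
  have "(\<lambda>w. (w 0, w 1)) ` ?W \<subseteq> ?B"
  proof (intro image_subsetI)
    fix w assume "w \<in> ?W"
    moreover have "cycle_edge L w 0 \<in> cycle_edge L w ` {..<L}" using L by auto
    ultimately have "edge (w 0) (w 1) \<in> E" using L by (simp add: cycle_edge_def)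
    moreover have "(w 0, w 1) = edge (w 0) (w 1) \<or> (w 0, w 1) = prod.swap (edge (w 0) (w 1))"
      by (auto simp: edge_def min_def max_def)
    ultimately show "(w 0, w 1) \<in> ?B"
      by (metis UnI1 UnI2 imageI)
  qed
  then have "card ?W \<le> card ?B"
    using inj E by (intro card_inj_on_le) auto
  also have "\<dots> \<le> card E + card (prod.swap ` E)" by (rule card_Un_le)
  also have "\<dots> \<le> 2 * L" using E card_image_le[of E prod.swap] by simp
  finally show ?thesis .
qed (simp only: card.empty)

text \<open>Group the marked cycles by edge set and bound each fibre by \<open>2 * L\<close>;
  nonnegativity of \<open>g\<close> permits replacing the fibre size by its bound. The predicate
  \<open>P\<close> will select the cycles all of whose edges are observed.\<close>

lemma sum_cycles_le_sum_edge_sets: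
  assumes L: "3 \<le> L" and T: "finite T" and g: "\<And>E. 0 \<le> (g E :: real)"
  shows "(\<Sum>w\<in>{w \<in> cycles L T. P w}. g (cycle_edge L w ` {..<L})) \<le>
    2 * real L * (\<Sum>E\<in>(\<lambda>w. cycle_edge L w ` {..<L}) ` {w \<in> cycles L T. P w}. g E)"
proof -
  let ?W = "{w \<in> cycles L T. P w}" and ?e = "\<lambda>w. cycle_edge L w ` {..<L}"
  have fin: "finite (cycles L T)" by (rule finite_cycles[OF T])
  have "(\<Sum>w\<in>?W. g (?e w)) = (\<Sum>E\<in>?e ` ?W. \<Sum>w\<in>{w \<in> ?W. ?e w = E}. g (?e w))"
    using fin by (intro sum.image_gen) auto
  also have "\<dots> \<le> (\<Sum>E\<in>?e ` ?W. 2 * real L * g E)"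
  proof (rule sum_mono)
    fix E
    have "(\<Sum>w\<in>{w \<in> ?W. ?e w = E}. g (?e w)) = real (card {w \<in> ?W. ?e w = E}) * g E"
      by simp
    also have "card {w \<in> ?W. ?e w = E} \<le> card {w \<in> cycles L T. ?e w = E}"
      using fin by (intro card_mono) auto
    then have "real (card {w \<in> ?W. ?e w = E}) * g E \<le> 2 * real L * g E"
      using card_cycles_with_edges_le[OF L, of T E] g[of E] by (intro mult_right_mono) linarith+
    finally show "(\<Sum>w\<in>{w \<in> ?W. ?e w = E}. g (?e w)) \<le> 2 * real L * g E" .
  qed
  finally show ?thesis by (simp add: sum_distrib_left)
qed

section \<open>Walks that revisit a vertex\<close>

text \<open>Coordinate \<open>j\<close> repeats coordinate \<open>i\<close>, so forgetting it is
  injective and only \<open>L - 1\<close> free coordinates remain.\<close>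

lemma card_PiE_eq_at_le:
  assumes T: "finite T" and ij: "i < L" "j < L" "i \<noteq> j"
  shows "card {w \<in> {..<L} \<rightarrow>\<^sub>E T. w i = w j} \<le> card T ^ (L - 1)"
proof -
  let ?W = "{w \<in> {..<L} \<rightarrow>\<^sub>E T. w i = w j}" and ?J = "{..<L} - {j}"
  have inj: "inj_on (\<lambda>w. restrict w ?J) ?W"
  proof (rule inj_onI)
    fix w w' assume ww: "w \<in> ?W" "w' \<in> ?W" and eq: "restrict w ?J = restrict w' ?J"
    have *: "w k = w' k" if "k \<in> ?J" for k
      using that fun_cong[OF eq, of k] by auto
    have "w j = w' j" using *[of i] ww ij by simp
    with * have "w k = w' k" if "k \<in> {..<L}" for k using that by (cases "k = j") auto
    with ww show "w = w'"
      by (intro PiE_ext[of w "{..<L}" "\<lambda>_. T" w']) auto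
  qed
  have "card ?W \<le> card (?J \<rightarrow>\<^sub>E T)"
    using T by (intro card_inj_on_le[OF inj] finite_PiE) (auto simp: PiE_iff extensional_def split: if_splits)
  also have "\<dots> = card T ^ (L - 1)"
    using ij by (simp add: card_PiE)
  finally show ?thesis .
qed

text \<open>Union bound over the pairs of colliding positions. For fixed \<open>L\<close> this is
  one order below the number \<open>card T ^ L\<close> of all walks.\<close>

lemma card_noninj_PiE_le:
  assumes T: "finite T"
  shows "card {w \<in> {..<L} \<rightarrow>\<^sub>E T. \<not> inj_on w {..<L}} \<le> L\<^sup>2 * card T ^ (L - 1)"
proof -
  let ?P = "{(i, j). i < L \<and> j < L \<and> i \<noteq> j}"
  have P: "?P \<subseteq> {..<L} \<times> {..<L}" by auto
  then have fP: "finite ?P" by (rule finite_subset) simp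
  have fin: "finite {w \<in> {..<L} \<rightarrow>\<^sub>E T. w i = w j}" for i j
    by (rule finite_subset[OF _ finite_PiE[of "{..<L}" "\<lambda>_. T"]]) (use T in auto)
  have "{w \<in> {..<L} \<rightarrow>\<^sub>E T. \<not> inj_on w {..<L}} \<subseteq>
      (\<Union>(i, j)\<in>?P. {w \<in> {..<L} \<rightarrow>\<^sub>E T. w i = w j})"
    by (auto simp: inj_on_def)
  then have "card {w \<in> {..<L} \<rightarrow>\<^sub>E T. \<not> inj_on w {..<L}} \<le>
      card (\<Union>(i, j)\<in>?P. {w \<in> {..<L} \<rightarrow>\<^sub>E T. w i = w j})"
    using fP fin by (intro card_mono) auto
  also have "\<dots> \<le> (\<Sum>p\<in>?P. card (case p of (i, j) \<Rightarrow> {w \<in> {..<L} \<rightarrow>\<^sub>E T. w i = w j}))"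
    by (rule card_UN_le[OF fP])
  also have "\<dots> \<le> (\<Sum>p\<in>?P. card T ^ (L - 1))"
    using card_PiE_eq_at_le[OF T] by (intro sum_mono) auto
  also have "\<dots> = card ?P * card T ^ (L - 1)" by simp
  also have "\<dots> \<le> L\<^sup>2 * card T ^ (L - 1)"
    using card_mono[OF _ P] by (intro mult_right_mono) (simp_all add: power2_eq_square card_cartesian_product)
  finally show ?thesis .
qed

section \<open>Asymptotics of closed walks in block-constant matrices\<close>

text \<open>The weight of a walk depends only on its sequence of blocks \<open>a\<close>, and the
  number of walks with that sequence is the product of the block sizes.\<close>

lemma cycle_sum_vimage:
  fixes \<phi> :: "'n::finite \<Rightarrow> 'n \<Rightarrow> real"
  assumes T: "finite T"
  shows "cycle_sum L (\<lambda>i j. \<phi> (q i) (q j)) T =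
    (\<Sum>a\<in>{..<L} \<rightarrow>\<^sub>E UNIV. (\<Prod>i<L. real (card {t \<in> T. q t = a i})) * (\<Prod>i<L. \<phi> (a i) (a (Suc i mod L))))"
proof -
  let ?W = "{..<L} \<rightarrow>\<^sub>E T" and ?r = "\<lambda>w. restrict (q \<circ> w) {..<L}"
  let ?h = "\<lambda>a. \<Prod>i<L. \<phi> (a i) (a (Suc i mod L))"
  have h: "?h (?r w) = (\<Prod>i<L. \<phi> (q (w i)) (q (w (Suc i mod L))))" for w
    by (intro prod.cong) auto
  have fin: "finite ?W" "finite ({..<L} \<rightarrow>\<^sub>E (UNIV :: 'n set))"
    using T by (auto intro!: finite_PiE)
  have "cycle_sum L (\<lambda>i j. \<phi> (q i) (q j)) T = (\<Sum>w\<in>?W. ?h (?r w))"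
    unfolding cycle_sum_def h ..
  also have "\<dots> = (\<Sum>a\<in>{..<L} \<rightarrow>\<^sub>E UNIV. \<Sum>w\<in>{w \<in> ?W. ?r w = a}. ?h (?r w))"
    using fin by (intro sum.group[symmetric]) auto
  also have "\<dots> = (\<Sum>a\<in>{..<L} \<rightarrow>\<^sub>E UNIV. real (card {w \<in> ?W. ?r w = a}) * ?h a)"
    by (intro sum.cong) auto
  also have "\<dots> = (\<Sum>a\<in>{..<L} \<rightarrow>\<^sub>E UNIV. (\<Prod>i<L. real (card {t \<in> T. q t = a i})) * ?h a)"
  proof (intro sum.cong refl)
    fix a :: "nat \<Rightarrow> 'n" assume a: "a \<in> {..<L} \<rightarrow>\<^sub>E UNIV"
    have "{w \<in> ?W. ?r w = a} = (\<Pi>\<^sub>E i\<in>{..<L}. {t \<in> T. q t = a i})"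
    proof (intro equalityI subsetI)
      fix w assume w: "w \<in> (\<Pi>\<^sub>E i\<in>{..<L}. {t \<in> T. q t = a i})"
      then have "?r w = a"
        using a by (intro PiE_ext[of _ "{..<L}" "\<lambda>_. UNIV" a]) (auto simp: PiE_iff)
      with w show "w \<in> {w \<in> ?W. ?r w = a}" by (auto simp: PiE_iff)
    next
      fix w assume "w \<in> {w \<in> ?W. ?r w = a}"
      then have w: "w \<in> ?W" and ra: "?r w = a" by simp_all
      have "q (w i) = a i" if "i < L" for i
        using that fun_cong[OF ra, of i] by simp
      with w show "w \<in> (\<Pi>\<^sub>E i\<in>{..<L}. {t \<in> T. q t = a i})"
        by (simp add: PiE_iff)
    qed
    then show "real (card {w \<in> ?W. ?r w = a}) * ?h a =
        (\<Prod>i<L. real (card {t \<in> T. q t = a i})) * ?h a"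
      by (simp add: card_PiE)
  qed
  finally show ?thesis .
qed

text \<open>Division by \<open>real N ^ L\<close> turns block sizes into frequencies, in a sum whose
  index set does not depend on \<open>N\<close>. Each position of a closed walk starts one step and
  ends another, so its factor \<rho> splits into two square roots, which gives the symmetric matrix
  with entries \<open>sqrt (\<rho> a) * \<phi> a b * sqrt (\<rho> b)\<close>.\<close>

lemma tendsto_cycle_sum_blocks:
  fixes \<phi> :: "'n::finite \<Rightarrow> 'n \<Rightarrow> real" and q :: "nat \<Rightarrow> nat \<Rightarrow> 'n"
  assumes \<rho>: "\<And>a. 0 \<le> \<rho> a"
    and lim: "\<And>a. (\<lambda>N. real (card {i \<in> {1..N}. q N i = a}) / real N) \<longlonglongrightarrow> \<rho> a"
  shows "(\<lambda>N. cycle_sum L (\<lambda>i j. \<phi> (q N i) (q N j)) {1..N} / real N ^ L) \<longlonglongrightarrow>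
    cycle_sum L (\<lambda>a b. sqrt (\<rho> a) * \<phi> a b * sqrt (\<rho> b)) UNIV"
proof -
  have "(\<lambda>N. \<Sum>a\<in>{..<L} \<rightarrow>\<^sub>E UNIV. (\<Prod>i<L. real (card {t \<in> {1..N}. q N t = a i}) / real N) *
      (\<Prod>i<L. \<phi> (a i) (a (Suc i mod L)))) \<longlonglongrightarrow>
    (\<Sum>a\<in>{..<L} \<rightarrow>\<^sub>E UNIV. (\<Prod>i<L. \<rho> (a i)) * (\<Prod>i<L. \<phi> (a i) (a (Suc i mod L))))"
    by (intro tendsto_intros lim)
  also have "(\<lambda>N. \<Sum>a\<in>{..<L} \<rightarrow>\<^sub>E UNIV. (\<Prod>i<L. real (card {t \<in> {1..N}. q N t = a i}) / real N) *
      (\<Prod>i<L. \<phi> (a i) (a (Suc i mod L)))) =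
    (\<lambda>N. cycle_sum L (\<lambda>i j. \<phi> (q N i) (q N j)) {1..N} / real N ^ L)"
    by (simp add: cycle_sum_vimage sum_divide_distrib prod_dividef)
  also have "(\<Sum>a\<in>{..<L} \<rightarrow>\<^sub>E UNIV. (\<Prod>i<L. \<rho> (a i)) * (\<Prod>i<L. \<phi> (a i) (a (Suc i mod L)))) =
    cycle_sum L (\<lambda>a b. sqrt (\<rho> a) * \<phi> a b * sqrt (\<rho> b)) UNIV"
    unfolding cycle_sum_def
  proof (intro sum.cong refl)
    fix a :: "nat \<Rightarrow> 'n"
    have "(\<Prod>i<L. sqrt (\<rho> (a i)) * \<phi> (a i) (a (Suc i mod L)) * sqrt (\<rho> (a (Suc i mod L)))) =
      (\<Prod>i<L. sqrt (\<rho> (a i))) * (\<Prod>i<L. \<phi> (a i) (a (Suc i mod L))) * (\<Prod>i<L. sqrt (\<rho> (a i)))"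
      by (simp add: prod.distrib prod_Suc_mod[of "\<lambda>i. sqrt (\<rho> (a i))"])
    also have "\<dots> = (\<Prod>i<L. sqrt (\<rho> (a i)) * sqrt (\<rho> (a i))) * (\<Prod>i<L. \<phi> (a i) (a (Suc i mod L)))"
      by (simp only: prod.distrib mult_ac)
    also have "\<dots> = (\<Prod>i<L. \<rho> (a i)) * (\<Prod>i<L. \<phi> (a i) (a (Suc i mod L)))"
      using \<rho> by simp
    finally show "(\<Prod>i<L. \<rho> (a i)) * (\<Prod>i<L. \<phi> (a i) (a (Suc i mod L))) =
      (\<Prod>i<L. sqrt (\<rho> (a i)) * \<phi> (a i) (a (Suc i mod L)) * sqrt (\<rho> (a (Suc i mod L))))" ..
  qed
  finally show ?thesis .
qed

text \<open>Passing from all closed walks to injective ones costs at most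
  \<open>C ^ L * L\<^sup>2 * N ^ (L - 1)\<close>, which vanishes after division by
  \<open>N ^ L\<close>.\<close>

lemma eventually_sum_cycles_blocks_gt:
  fixes \<phi> :: "'n::finite \<Rightarrow> 'n \<Rightarrow> real" and q :: "nat \<Rightarrow> nat \<Rightarrow> 'n"
  assumes \<rho>: "\<And>a. 0 \<le> \<rho> a"
    and lim: "\<And>a. (\<lambda>N. real (card {i \<in> {1..N}. q N i = a}) / real N) \<longlonglongrightarrow> \<rho> a"
    and \<phi>: "\<And>a b. 0 \<le> \<phi> a b"
    and L: "0 < L"
    and K: "K < cycle_sum L (\<lambda>a b. sqrt (\<rho> a) * \<phi> a b * sqrt (\<rho> b)) UNIV"
  shows "\<forall>\<^sub>F N in sequentially. K * real N ^ L <
    (\<Sum>w\<in>cycles L {1..N}. \<Prod>i<L. \<phi> (q N (w i)) (q N (w (Suc i mod L))))"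
proof -
  \<comment> \<open>The sum of all entries is a crude bound for each of them, since they are
    nonnegative.\<close>
  define C where "C = (\<Sum>a\<in>UNIV. \<Sum>b\<in>UNIV. \<phi> a b)"
  have C: "\<phi> a b \<le> C" for a b
  proof -
    have "\<phi> a b \<le> (\<Sum>b\<in>UNIV. \<phi> a b)" using \<phi> by (intro member_le_sum) auto
    also have "\<dots> \<le> C" unfolding C_def using \<phi> by (intro member_le_sum sum_nonneg) auto
    finally show ?thesis .
  qed
  define h where "h N w = (\<Prod>i<L. \<phi> (q N (w i)) (q N (w (Suc i mod L))))" for N w
  let ?c = "\<lambda>N. cycle_sum L (\<lambda>i j. \<phi> (q N i) (q N j)) {1..N}"
  let ?s = "\<lambda>N. \<Sum>w\<in>cycles L {1..N}. h N w"
  have le: "?c N / real N ^ L - C ^ L * (real L)\<^sup>2 / real N \<le> ?s N / real N ^ L" if N: "0 < N" for N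
  proof -
    let ?W = "{..<L} \<rightarrow>\<^sub>E {1..N}"
    let ?n = "{w \<in> ?W. \<not> inj_on w {..<L}}"
    have fin: "finite ?W" by (auto intro!: finite_PiE)
    have "?c N = (\<Sum>w\<in>cycles L {1..N} \<union> ?n. h N w)"
      unfolding cycle_sum_def h_def by (intro sum.cong) (auto simp: cycles_def)
    also have "\<dots> = ?s N + (\<Sum>w\<in>?n. h N w)"
      using fin by (intro sum.union_disjoint) (auto simp: cycles_def)
    also have "(\<Sum>w\<in>?n. h N w) \<le> (\<Sum>w\<in>?n. C ^ L)"
    proof (rule sum_mono)
      fix w
      have "h N w \<le> (\<Prod>i<L. C)" unfolding h_def using \<phi> C by (intro prod_mono) auto
      then show "h N w \<le> C ^ L" by simp
    qed
    also have "(\<Sum>w\<in>?n. C ^ L) = real (card ?n) * C ^ L" by simp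
    also have "\<dots> \<le> (real L)\<^sup>2 * real N ^ (L - 1) * C ^ L"
    proof (rule mult_right_mono)
      have "real (card ?n) \<le> real (L\<^sup>2 * card {1..N} ^ (L - 1))"
        by (intro of_nat_mono card_noninj_PiE_le) simp
      then show "real (card ?n) \<le> (real L)\<^sup>2 * real N ^ (L - 1)" by simp
      show "0 \<le> C ^ L" using C[of undefined undefined] \<phi>[of undefined undefined] by simp
    qed
    finally have "?c N \<le> ?s N + (real L)\<^sup>2 * real N ^ (L - 1) * C ^ L" by simp
    then have "?c N / real N ^ L \<le> (?s N + (real L)\<^sup>2 * real N ^ (L - 1) * C ^ L) / real N ^ L"
      by (intro divide_right_mono) auto
    also have "\<dots> = ?s N / real N ^ L + C ^ L * (real L)\<^sup>2 / real N"
      using N L by (cases L) (simp_all add: add_divide_distrib)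
    finally show ?thesis by simp
  qed
  have "(\<lambda>N. ?c N / real N ^ L - C ^ L * (real L)\<^sup>2 / real N) \<longlonglongrightarrow>
      cycle_sum L (\<lambda>a b. sqrt (\<rho> a) * \<phi> a b * sqrt (\<rho> b)) UNIV - 0"
    by (intro tendsto_diff tendsto_cycle_sum_blocks \<rho> lim lim_const_over_n)
  then have "\<forall>\<^sub>F N in sequentially. K < ?c N / real N ^ L - C ^ L * (real L)\<^sup>2 / real N"
    using K by (intro order_tendstoD(1)) auto
  then show ?thesis
    using eventually_gt_at_top[of 0]
  proof eventually_elim
    case (elim N)
    then have "K < ?s N / real N ^ L" using le[of N] by simp
    then show ?case using elim(2) by (simp add: h_def pos_less_divide_eq)
  qed
qed

section \<open>Mixtures and products of measures\<close>

text \<open>Fubini for a mixture of laws: the identity for nonnegative functions is applied to the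
  positive and negative parts of \<open>f\<close>, and the finite absolute moment makes their
  difference legitimate.\<close>

lemma integral_bind_kernel:
  fixes f :: "'b \<Rightarrow> real"
  assumes M: "space M \<noteq> {}" and K[measurable]: "K \<in> M \<rightarrow>\<^sub>M subprob_algebra N"
    and f[measurable]: "f \<in> borel_measurable N"
    and fin: "(\<integral>\<^sup>+x. \<integral>\<^sup>+y. ennreal \<bar>f y\<bar> \<partial>K x \<partial>M) < \<infinity>"
  shows "integrable (Giry_Monad.bind M K) f"
    and "(\<integral>y. f y \<partial>Giry_Monad.bind M K) = (\<integral>x. (\<integral>y. f y \<partial>K x) \<partial>M)"
proof -
  have sets_K: "sets (K x) = sets N" if "x \<in> space M" for x
    using measurable_space[OF K that] by (simp add: space_subprob_algebra)
  have sets_bind: "sets (Giry_Monad.bind M K) = sets N"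
    using sets_K M by (rule sets_bind)
  have meas[measurable]: "(\<lambda>x. \<integral>\<^sup>+y. ennreal (g y) \<partial>K x) \<in> borel_measurable M"
    if [measurable]: "g \<in> borel_measurable N" for g :: "'b \<Rightarrow> real"
    by (rule measurable_compose[OF K nn_integral_measurable_subprob_algebra]) simp
  have bind: "(\<integral>\<^sup>+y. ennreal (g y) \<partial>Giry_Monad.bind M K) = (\<integral>\<^sup>+x. \<integral>\<^sup>+y. ennreal (g y) \<partial>K x \<partial>M)"
    if [measurable]: "g \<in> borel_measurable N" for g :: "'b \<Rightarrow> real"
    by (rule nn_integral_bind[OF _ K]) simp
  have f_bind: "f \<in> borel_measurable (Giry_Monad.bind M K)"
    using f measurable_cong_sets[OF sets_bind refl] by blast
  show int: "integrable (Giry_Monad.bind M K) f"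
    using fin f_bind by (intro integrableI_bounded) (simp_all add: bind)
  have AE_fin: "AE x in M. (\<integral>\<^sup>+y. ennreal \<bar>f y\<bar> \<partial>K x) < \<infinity>"
    using nn_integral_PInf_AE[OF meas[of "\<lambda>y. \<bar>f y\<bar>"]] fin by (auto simp: less_top)
  \<comment> \<open>Since \<open>ennreal\<close> sends negative numbers to 0, the choices
    \<open>g = f\<close> and \<open>g = - f\<close> give the positive and the negative part.\<close>
  have part: "integrable M (\<lambda>x. enn2real (\<integral>\<^sup>+y. ennreal (g y) \<partial>K x)) \<and>
      (\<integral>x. enn2real (\<integral>\<^sup>+y. ennreal (g y) \<partial>K x) \<partial>M) =
      enn2real (\<integral>\<^sup>+y. ennreal (g y) \<partial>Giry_Monad.bind M K)"
    if g[measurable]: "g \<in> borel_measurable N" and le: "\<And>y. g y \<le> \<bar>f y\<bar>" for g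
  proof -
    let ?A = "\<lambda>x. \<integral>\<^sup>+y. ennreal (g y) \<partial>K x"
    have A_le: "?A x \<le> (\<integral>\<^sup>+y. ennreal \<bar>f y\<bar> \<partial>K x)" for x
      by (intro nn_integral_mono ennreal_leI le)
    have "AE x in M. ennreal (enn2real (?A x)) = ?A x"
      using AE_fin by eventually_elim (metis A_le ennreal_enn2real infinity_ennreal_def order_le_less_trans)
    then have eq: "(\<integral>\<^sup>+x. ennreal (enn2real (?A x)) \<partial>M) = (\<integral>\<^sup>+x. ?A x \<partial>M)"
      by (rule nn_integral_cong_AE)
    have "(\<integral>\<^sup>+x. ?A x \<partial>M) \<le> (\<integral>\<^sup>+x. \<integral>\<^sup>+y. ennreal \<bar>f y\<bar> \<partial>K x \<partial>M)"
      by (intro nn_integral_mono A_le)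
    with fin eq have fin_A: "(\<integral>\<^sup>+x. ennreal (enn2real (?A x)) \<partial>M) < \<infinity>" by simp
    have "integrable M (\<lambda>x. enn2real (?A x))"
      using fin_A by (intro integrableI_bounded) auto
    moreover have "(\<integral>x. enn2real (?A x) \<partial>M) = enn2real (\<integral>\<^sup>+x. ennreal (enn2real (?A x)) \<partial>M)"
      by (rule integral_eq_nn_integral) auto
    ultimately show ?thesis by (simp add: eq bind)
  qed
  have inner: "AE x in M. (\<integral>y. f y \<partial>K x) =
      enn2real (\<integral>\<^sup>+y. ennreal (f y) \<partial>K x) - enn2real (\<integral>\<^sup>+y. ennreal (- f y) \<partial>K x)"
    using AE_fin AE_space
  proof eventually_elim
    case (elim x)
    have "f \<in> borel_measurable (K x)"
      using f measurable_cong_sets[OF sets_K[OF elim(2)] refl] by blast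
    with elim(1) have "integrable (K x) f"
      by (intro integrableI_bounded) simp_all
    then show ?case by (rule real_lebesgue_integral_def)
  qed
  have "(\<integral>x. (\<integral>y. f y \<partial>K x) \<partial>M) =
      (\<integral>x. enn2real (\<integral>\<^sup>+y. ennreal (f y) \<partial>K x) - enn2real (\<integral>\<^sup>+y. ennreal (- f y) \<partial>K x) \<partial>M)"
    using K f by (intro integral_cong_AE inner) measurable
  also have "\<dots> = enn2real (\<integral>\<^sup>+y. ennreal (f y) \<partial>Giry_Monad.bind M K) -
      enn2real (\<integral>\<^sup>+y. ennreal (- f y) \<partial>Giry_Monad.bind M K)"
    using part[of f] part[of "\<lambda>y. - f y"] by simp
  also have "\<dots> = (\<integral>y. f y \<partial>Giry_Monad.bind M K)"
    using int by (rule real_lebesgue_integral_def[symmetric])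
  finally show "(\<integral>y. f y \<partial>Giry_Monad.bind M K) = (\<integral>x. (\<integral>y. f y \<partial>K x) \<partial>M)" ..
qed

text \<open>The locale \<open>product_prob_space\<close> constrains factors outside \<open>J\<close>
  as well. As \<open>PiM J\<close> depends only on the factors in \<open>J\<close>, the others are
  replaced by point masses.\<close>

lemma PiM_override:
  assumes "\<And>j. j \<in> J \<Longrightarrow> prob_space (M j)"
  shows "\<exists>M'. product_prob_space M' \<and> (\<forall>j\<in>J. M' j = M j) \<and> PiM J M = PiM J M'"
proof -
  define M' where "M' j = (if j \<in> J then M j else return (count_space UNIV) undefined)" for j
  have "product_prob_space M'"
    using assms by (intro product_prob_spaceI) (auto simp: M'_def prob_space_return)
  moreover have "PiM J M = PiM J M'"
    by (intro PiM_cong) (auto simp: M'_def)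
  ultimately show ?thesis by (intro exI[of _ M']) (simp add: M'_def)
qed

lemma integral_PiM_prod:
  fixes f :: "'i \<Rightarrow> 'a \<Rightarrow> real"
  assumes J: "finite J" and M: "\<And>j. j \<in> J \<Longrightarrow> prob_space (M j)"
    and f: "\<And>j. j \<in> J \<Longrightarrow> integrable (M j) (f j)"
  shows "integrable (PiM J M) (\<lambda>x. \<Prod>j\<in>J. f j (x j))"
    and "(\<integral>x. (\<Prod>j\<in>J. f j (x j)) \<partial>PiM J M) = (\<Prod>j\<in>J. \<integral>y. f j y \<partial>M j)"
proof -
  obtain M' where M': "product_prob_space M'" "\<And>j. j \<in> J \<Longrightarrow> M' j = M j" "PiM J M = PiM J M'"
    using PiM_override[of J M, OF M] by blast
  interpret product_prob_space M' by (rule M'(1))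
  have f': "integrable (M' j) (f j)" if "j \<in> J" for j
    using f M'(2) that by simp
  show "integrable (PiM J M) (\<lambda>x. \<Prod>j\<in>J. f j (x j))"
    unfolding M'(3) using J f' by (rule product_integrable_prod)
  show "(\<integral>x. (\<Prod>j\<in>J. f j (x j)) \<partial>PiM J M) = (\<Prod>j\<in>J. \<integral>y. f j y \<partial>M j)"
    unfolding M'(3) using product_integral_prod[OF J f'] M'(2) by simp
qed

text \<open>Coordinates not hit by \<open>u\<close> receive the constant factor 1, whose integral is
  1. This serves products over the vertices of a cycle and over its edges.\<close>

lemma integral_PiM_prod_inj:
  fixes g :: "'k \<Rightarrow> 'a \<Rightarrow> real"
  assumes J: "finite J" and M: "\<And>j. j \<in> J \<Longrightarrow> prob_space (M j)"
    and u: "inj_on u I" "u ` I \<subseteq> J"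
    and g: "\<And>i. i \<in> I \<Longrightarrow> integrable (M (u i)) (g i)"
  shows "integrable (PiM J M) (\<lambda>x. \<Prod>i\<in>I. g i (x (u i)))" (is ?thesis1)
    and "(\<integral>x. (\<Prod>i\<in>I. g i (x (u i))) \<partial>PiM J M) = (\<Prod>i\<in>I. \<integral>y. g i y \<partial>M (u i))" (is ?thesis2)
proof -
  define f where "f j = (if j \<in> u ` I then g (the_inv_into I u j) else (\<lambda>_. 1))" for j
  have f_u: "f (u i) = g i" if "i \<in> I" for i
    using that u(1) by (simp add: f_def the_inv_into_f_f)
  have extend: "(\<Prod>j\<in>J. h j) = (\<Prod>i\<in>I. h (u i))" if "\<And>j. j \<in> J - u ` I \<Longrightarrow> h j = 1" for h :: "_ \<Rightarrow> real"
    using that prod.mono_neutral_right[OF J u(2), of h] prod.reindex[OF u(1), of h] by (simp add: o_def)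
  have eq: "(\<Prod>j\<in>J. f j (x j)) = (\<Prod>i\<in>I. g i (x (u i)))" for x
    using extend[of "\<lambda>j. f j (x j)"] by (simp add: f_u) (simp add: f_def)
  have f: "integrable (M j) (f j)" if "j \<in> J" for j
  proof (cases "j \<in> u ` I")
    case True
    then show ?thesis using g f_u by auto
  next
    case False
    interpret prob_space "M j" by (rule M[OF that])
    show ?thesis using False by (simp add: f_def)
  qed
  show ?thesis1
    using integral_PiM_prod(1)[of J M f, OF J M f] by (simp add: eq)
  have "(\<integral>x. (\<Prod>i\<in>I. g i (x (u i))) \<partial>PiM J M) = (\<Prod>j\<in>J. \<integral>y. f j y \<partial>M j)"
    using integral_PiM_prod(2)[of J M f, OF J M f] by (simp add: eq)
  also have "\<dots> = (\<Prod>i\<in>I. \<integral>y. f (u i) y \<partial>M (u i))"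
  proof (rule extend)
    fix j assume "j \<in> J - u ` I"
    then interpret prob_space "M j" using M by simp
    show "(\<integral>y. f j y \<partial>M j) = 1"
      using \<open>j \<in> J - u ` I\<close> by (simp add: f_def prob_space)
  qed
  also have "\<dots> = (\<Prod>i\<in>I. \<integral>y. g i y \<partial>M (u i))"
    by (intro prod.cong) (simp_all add: f_u)
  finally show ?thesis2 .
qed

section \<open>Gaussian product measures\<close>

lemma prob_space_gaussian: "0 < v \<Longrightarrow> prob_space (gaussian \<mu> v)"
  unfolding gaussian_def by (rule prob_space_normal_density) simp

lemma sets_gaussian [measurable_cong, simp]: "sets (gaussian \<mu> v) = sets borel"
  by (simp add: gaussian_def)

lemma space_gaussian [simp]: "space (gaussian \<mu> v) = UNIV"
  by (simp add: gaussian_def)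

lemma has_bochner_integral_gaussian:
  fixes f :: "real \<Rightarrow> real"
  assumes "f \<in> borel_measurable borel"
    and "has_bochner_integral lborel (\<lambda>y. normal_density \<mu> (sqrt v) y * f y) c"
  shows "integrable (gaussian \<mu> v) f" "(\<integral>y. f y \<partial>gaussian \<mu> v) = c"
  using assms
  by (auto simp: gaussian_def integrable_density integral_density has_bochner_integral_iff)

lemma gaussian_mean:
  assumes "0 < v"
  shows "integrable (gaussian \<mu> v) (\<lambda>y. y)" "(\<integral>y. y \<partial>gaussian \<mu> v) = \<mu>"
  using assms by (auto intro!: has_bochner_integral_gaussian normal_moment_nz_1)

lemma gaussian_second_moment:
  assumes "0 < v"
  shows "integrable (gaussian 0 v) (\<lambda>y. y\<^sup>2)" "(\<integral>y. y\<^sup>2 \<partial>gaussian 0 v) = v"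
proof -
  have "has_bochner_integral lborel (\<lambda>y. normal_density 0 (sqrt v) y * y\<^sup>2) v"
    using normal_moment_even[of "sqrt v" 0 1] assms by simp
  then show "integrable (gaussian 0 v) (\<lambda>y. y\<^sup>2)" "(\<integral>y. y\<^sup>2 \<partial>gaussian 0 v) = v"
    by (auto intro!: has_bochner_integral_gaussian)
qed

lemma gaussian_moment_le_2:
  assumes v: "0 < v" and k: "k \<le> 2"
  shows "integrable (gaussian 0 v) (\<lambda>y. y ^ k)"
    and "(\<integral>y. y ^ k \<partial>gaussian 0 v) = (if k = 0 then 1 else if k = 1 then 0 else v)"
proof -
  interpret prob_space "gaussian 0 v" by (rule prob_space_gaussian[OF v])
  consider "k = 0" | "k = 1" | "k = 2" using k by linarith
  then have "integrable (gaussian 0 v) (\<lambda>y. y ^ k) \<and>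
    (\<integral>y. y ^ k \<partial>gaussian 0 v) = (if k = 0 then 1 else if k = 1 then 0 else v)"
  proof cases
    case 1
    then show ?thesis using prob_space by simp
  next
    case 2
    then show ?thesis using gaussian_mean[OF v, of 0] by simp
  next
    case 3
    then show ?thesis using gaussian_second_moment[OF v] by simp
  qed
  then show "integrable (gaussian 0 v) (\<lambda>y. y ^ k)"
    and "(\<integral>y. y ^ k \<partial>gaussian 0 v) = (if k = 0 then 1 else if k = 1 then 0 else v)"
    by simp_all
qed

lemma gaussian_abs_moment_le:
  assumes "0 < v"
  shows "integrable (gaussian \<mu> v) (\<lambda>y. \<bar>y\<bar>)" "(\<integral>y. \<bar>y\<bar> \<partial>gaussian \<mu> v) \<le> \<bar>\<mu>\<bar> + sqrt v * sqrt (2 / pi)"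
proof -
  interpret prob_space "gaussian \<mu> v" by (rule prob_space_gaussian[OF assms])
  show int: "integrable (gaussian \<mu> v) (\<lambda>y. \<bar>y\<bar>)"
    using gaussian_mean(1)[OF assms] by (rule integrable_abs)
  have "has_bochner_integral lborel (\<lambda>y. normal_density \<mu> (sqrt v) y * \<bar>y - \<mu>\<bar>) (sqrt v * sqrt (2 / pi))"
    using normal_moment_abs_odd[of "sqrt v" \<mu> 0] assms by simp
  then have dev: "integrable (gaussian \<mu> v) (\<lambda>y. \<bar>y - \<mu>\<bar>)"
      "(\<integral>y. \<bar>y - \<mu>\<bar> \<partial>gaussian \<mu> v) = sqrt v * sqrt (2 / pi)"
    by (auto intro!: has_bochner_integral_gaussian)
  have "(\<integral>y. \<bar>y\<bar> \<partial>gaussian \<mu> v) \<le> (\<integral>y. \<bar>\<mu>\<bar> + \<bar>y - \<mu>\<bar> \<partial>gaussian \<mu> v)"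
    using int dev(1) by (intro integral_mono) auto
  also have "\<dots> = \<bar>\<mu>\<bar> + sqrt v * sqrt (2 / pi)"
    using dev prob_space by simp
  finally show "(\<integral>y. \<bar>y\<bar> \<partial>gaussian \<mu> v) \<le> \<bar>\<mu>\<bar> + sqrt v * sqrt (2 / pi)" .
qed

lemma distr_gaussian_plus: "distr (gaussian 0 v) borel (\<lambda>z. x + z) = gaussian x v"
proof -
  have "gaussian x v = density (distr lborel borel (\<lambda>z. x + z)) (\<lambda>y. ennreal (normal_density x (sqrt v) y))"
    by (simp add: gaussian_def lborel_distr_plus)
  also have "\<dots> = distr (density lborel (\<lambda>z. ennreal (normal_density x (sqrt v) (x + z)))) borel (\<lambda>z. x + z)"
    by (rule density_distr) auto
  also have "(\<lambda>z. normal_density x (sqrt v) (x + z)) = normal_density 0 (sqrt v)"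
    by (simp add: normal_density_def fun_eq_iff)
  finally show ?thesis by (simp add: gaussian_def)
qed

text \<open>Observation equals signal plus centred noise: the two laws agree on boxes, by
  translating each coordinate.\<close>

lemma distr_PiM_gaussian_plus:
  assumes J: "finite J" and v: "\<And>e. e \<in> J \<Longrightarrow> 0 < v e"
  shows "distr (PiM J (\<lambda>e. gaussian 0 (v e))) (PiM J (\<lambda>_. borel)) (\<lambda>z. \<lambda>e\<in>J. x e + z e) =
    PiM J (\<lambda>e. gaussian (x e) (v e))" (is "?D = _")
proof -
  let ?G0 = "\<lambda>e. gaussian 0 (v e)" and ?Gx = "\<lambda>e. gaussian (x e) (v e)"
  have G: "prob_space (gaussian (y e) (v e))" if "e \<in> J" for e y
    using v[OF that] by (rule prob_space_gaussian)
  obtain M' where M': "product_prob_space M'" "\<And>j. j \<in> J \<Longrightarrow> M' j = ?Gx j" "PiM J ?Gx = PiM J M'"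
    using PiM_override[of J ?Gx, OF G[of _ x]] by blast
  obtain M0 where M0: "product_prob_space M0" "\<And>j. j \<in> J \<Longrightarrow> M0 j = ?G0 j" "PiM J ?G0 = PiM J M0"
    using PiM_override[of J ?G0, OF G[of _ "\<lambda>_. 0"]] by blast
  interpret M': product_prob_space M' by (rule M'(1))
  interpret M0: product_prob_space M0 by (rule M0(1))
  have meas: "(\<lambda>z. \<lambda>e\<in>J. x e + z e) \<in> PiM J ?G0 \<rightarrow>\<^sub>M PiM J (\<lambda>_. borel)"
    by measurable
  have "?D = PiM J M'"
  proof (rule M'.PiM_eqI[OF J])
    show "sets ?D = sets (PiM J M')"
      unfolding sets_distr by (intro sets_PiM_cong) (auto simp: M'(2))
    fix A assume A: "\<And>i. i \<in> J \<Longrightarrow> A i \<in> sets (M' i)"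
    then have A': "A i \<in> sets borel" if "i \<in> J" for i using that by (simp add: M'(2))
    let ?B = "\<lambda>i. (\<lambda>z. x i + z) -` A i"
    have B: "?B i \<in> sets borel" if "i \<in> J" for i
      using measurable_sets[of "\<lambda>z. x i + z" borel borel "A i"] A'[OF that] by simp
    have "emeasure ?D (Pi\<^sub>E J A) =
        emeasure (PiM J ?G0) ((\<lambda>z. \<lambda>e\<in>J. x e + z e) -` (Pi\<^sub>E J A) \<inter> space (PiM J ?G0))"
      using J A' by (intro emeasure_distr meas sets_PiM_I_finite) auto
    also have "(\<lambda>z. \<lambda>e\<in>J. x e + z e) -` (Pi\<^sub>E J A) \<inter> space (PiM J ?G0) = Pi\<^sub>E J ?B"
      by (auto simp: space_PiM PiE_iff)
    also have "emeasure (PiM J ?G0) (Pi\<^sub>E J ?B) = (\<Prod>i\<in>J. emeasure (M0 i) (?B i))"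
      unfolding M0(3)
    proof (rule M0.emeasure_PiM[OF J])
      fix i assume i: "i \<in> J"
      show "?B i \<in> sets (M0 i)"
        unfolding M0(2)[OF i] sets_gaussian by (rule B[OF i])
    qed
    also have "\<dots> = (\<Prod>i\<in>J. emeasure (M' i) (A i))"
    proof (intro prod.cong refl)
      fix i assume i: "i \<in> J"
      have "emeasure (gaussian (x i) (v i)) (A i) = emeasure (gaussian 0 (v i)) (?B i \<inter> space (gaussian 0 (v i)))"
        using A'[OF i] by (subst distr_gaussian_plus[symmetric], intro emeasure_distr) auto
      then show "emeasure (M0 i) (?B i) = emeasure (M' i) (A i)"
        using i by (simp add: M0(2) M'(2))
    qed
    finally show "emeasure ?D (Pi\<^sub>E J A) = (\<Prod>i\<in>J. emeasure (M' i) (A i))" .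
  qed
  then show ?thesis by (simp add: M'(3))
qed

text \<open>By the translation identity the law is the image of one fixed noise measure under a map
  jointly measurable in signal and noise, so it depends measurably on the signal and can serve as a
  kernel.\<close>

lemma measurable_PiM_gaussian:
  assumes J: "finite J" "J \<subseteq> I" and v: "\<And>e. e \<in> J \<Longrightarrow> 0 < v e"
  shows "(\<lambda>x. PiM J (\<lambda>e. gaussian (x e) (v e))) \<in>
    PiM I (\<lambda>_. borel) \<rightarrow>\<^sub>M subprob_algebra (PiM J (\<lambda>_. borel))"
proof -
  let ?G0 = "PiM J (\<lambda>e. gaussian 0 (v e))"
  have sets_P: "sets ?G0 = sets (PiM J (\<lambda>_. borel))"
    by (intro sets_PiM_cong) auto
  interpret prob_space ?G0
    using v by (intro prob_space_PiM prob_space_gaussian)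
  have "?G0 \<in> space (subprob_algebra (PiM J (\<lambda>_. borel)))"
    using sets_P by (simp add: space_subprob_algebra subprob_space_axioms)
  moreover have "(\<lambda>(x, z). \<lambda>e\<in>J. x e + z e) \<in>
      PiM I (\<lambda>_. borel) \<Otimes>\<^sub>M PiM J (\<lambda>_. borel) \<rightarrow>\<^sub>M PiM J (\<lambda>_. borel :: real measure)"
    unfolding case_prod_beta
  proof (rule measurable_restrict)
    fix e assume "e \<in> J"
    then have [measurable]: "e \<in> J" "e \<in> I" using J by auto
    show "(\<lambda>p. fst p e + snd p e) \<in> borel_measurable (PiM I (\<lambda>_. borel) \<Otimes>\<^sub>M PiM J (\<lambda>_. borel :: real measure))"
      by measurable
  qed
  ultimately have "(\<lambda>x. distr ?G0 (PiM J (\<lambda>_. borel)) (\<lambda>z. \<lambda>e\<in>J. x e + z e)) \<in>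
      PiM I (\<lambda>_. borel) \<rightarrow>\<^sub>M subprob_algebra (PiM J (\<lambda>_. borel))"
    by (intro measurable_distr2) (auto intro: measurable_const)
  then show ?thesis
    using J v by (simp add: distr_PiM_gaussian_plus)
qed

section \<open>Topological support of a measure\<close>

text \<open>A point outside the support lies in a basic open set of measure zero, and a countable
  basis has only countably many of these.\<close>

lemma AE_in_support:
  fixes \<nu> :: "'a::second_countable_topology measure"
  assumes sets: "sets \<nu> = sets borel"
  shows "AE x in \<nu>. x \<in> support \<nu>"
proof -
  obtain B :: "'a set set" where B: "countable B" "topological_basis B"
    using ex_countable_basis by blast
  let ?Z = "{b \<in> B. emeasure \<nu> b = 0}"
  have null: "AE x in \<nu>. x \<notin> b" if "b \<in> ?Z" for b
  proof (rule AE_not_in)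
    have "open b" using that topological_basis_open[OF B(2)] by simp
    then show "b \<in> null_sets \<nu>" using that sets by auto
  qed
  have "AE x in \<nu>. \<forall>b\<in>?Z. x \<notin> b"
    using B(1) null by (subst AE_ball_countable) auto
  then show ?thesis
  proof eventually_elim
    case (elim x)
    show ?case
      unfolding support_def
    proof (intro CollectI allI impI)
      fix U assume U: "open U \<and> x \<in> U"
      then obtain b where b: "b \<in> B" "x \<in> b" "b \<subseteq> U"
        using topological_basisE[OF B(2), of U x] by metis
      then have "emeasure \<nu> b \<noteq> 0" using elim by auto
      moreover have "emeasure \<nu> b \<le> emeasure \<nu> U"
        using b(3) U sets by (intro emeasure_mono) auto
      ultimately show "0 < emeasure \<nu> U" by (auto simp: zero_less_iff_neq_zero)
    qed
  qed
qed

section \<open>Square-free test polynomials\<close>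

definition squarefree_monomial :: "'v set \<Rightarrow> 'v \<Rightarrow>\<^sub>0 nat" where
  "squarefree_monomial E = (\<Sum>e\<in>E. Poly_Mapping.single e 1)"

lemma lookup_squarefree_monomial:
  "finite E \<Longrightarrow> Poly_Mapping.lookup (squarefree_monomial E) e = (if e \<in> E then 1 else 0)"
  by (simp add: squarefree_monomial_def lookup_sum lookup_single when_def)

lemma keys_squarefree_monomial: "finite E \<Longrightarrow> Poly_Mapping.keys (squarefree_monomial E) = E"
  by (auto simp: in_keys_iff lookup_squarefree_monomial split: if_splits)

lemma inj_on_squarefree_monomial:
  "(\<And>E. E \<in> \<E> \<Longrightarrow> finite E) \<Longrightarrow> inj_on squarefree_monomial \<E>"
  by (metis inj_onI keys_squarefree_monomial)

definition squarefree_poly :: "'v set set \<Rightarrow> ('v set \<Rightarrow> real) \<Rightarrow> 'v polynomial" where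
  "squarefree_poly \<E> c = (\<Sum>E\<in>\<E>. Poly_Mapping.single (squarefree_monomial E) (c E))"

lemma keys_squarefree_poly_subset:
  "Poly_Mapping.keys (squarefree_poly \<E> c) \<subseteq> squarefree_monomial ` \<E>"
proof -
  have "Poly_Mapping.keys (squarefree_poly \<E> c) \<subseteq>
      (\<Union>E\<in>\<E>. Poly_Mapping.keys (Poly_Mapping.single (squarefree_monomial E) (c E)))"
    unfolding squarefree_poly_def by (rule keys_sum)
  also have "\<dots> \<subseteq> squarefree_monomial ` \<E>" by (auto split: if_splits)
  finally show ?thesis .
qed

text \<open>Distinct edge sets give distinct monomials, so no coefficients merge.\<close>

lemma poly_eval_squarefree_poly:
  assumes \<E>: "finite \<E>" "\<And>E. E \<in> \<E> \<Longrightarrow> finite E"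
  shows "poly_eval (squarefree_poly \<E> c) y = (\<Sum>E\<in>\<E>. c E * (\<Prod>e\<in>E. y e))"
proof -
  note inj = inj_on_squarefree_monomial[OF \<E>(2)]
  have lookup: "Poly_Mapping.lookup (squarefree_poly \<E> c) (squarefree_monomial E) = c E" if "E \<in> \<E>" for E
  proof -
    have "Poly_Mapping.lookup (squarefree_poly \<E> c) (squarefree_monomial E) =
        (\<Sum>F\<in>\<E>. if F = E then c F else 0)"
      unfolding squarefree_poly_def lookup_sum
    proof (intro sum.cong refl)
      fix F assume "F \<in> \<E>"
      then have "squarefree_monomial F = squarefree_monomial E \<longleftrightarrow> F = E"
        using inj that by (auto dest: inj_onD)
      then show "Poly_Mapping.lookup (Poly_Mapping.single (squarefree_monomial F) (c F)) (squarefree_monomial E) =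
          (if F = E then c F else 0)"
        by (simp add: lookup_single when_def)
    qed
    then show ?thesis using \<E>(1) that by simp
  qed
  \<comment> \<open>The key set may be smaller than the image of \<E>, because zero coefficients are
    dropped; the added terms vanish.\<close>
  have "poly_eval (squarefree_poly \<E> c) y =
      (\<Sum>m\<in>squarefree_monomial ` \<E>. Poly_Mapping.lookup (squarefree_poly \<E> c) m *
        (\<Prod>p\<in>Poly_Mapping.keys m. y p ^ Poly_Mapping.lookup m p))"
    unfolding poly_eval_def using \<E>(1) keys_squarefree_poly_subset
    by (intro sum.mono_neutral_left) (auto simp: in_keys_iff)
  also have "\<dots> = (\<Sum>E\<in>\<E>. c E * (\<Prod>e\<in>E. y e))"
  proof (rule sum.reindex_cong[OF inj refl])
    fix E assume E: "E \<in> \<E>"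
    show "Poly_Mapping.lookup (squarefree_poly \<E> c) (squarefree_monomial E) *
        (\<Prod>p\<in>Poly_Mapping.keys (squarefree_monomial E). y p ^ Poly_Mapping.lookup (squarefree_monomial E) p) =
        c E * (\<Prod>e\<in>E. y e)"
      using lookup[OF E] \<E>(2)[OF E] by (simp add: keys_squarefree_monomial lookup_squarefree_monomial)
  qed
  finally show ?thesis .
qed

lemma squarefree_poly_in_polys_upto:
  assumes "\<And>E. E \<in> \<E> \<Longrightarrow> finite E \<and> E \<subseteq> J \<and> card E \<le> D"
  shows "squarefree_poly \<E> c \<in> polys_upto J D"
  using assms keys_squarefree_poly_subset[of \<E> c]
  by (fastforce simp: polys_upto_def keys_squarefree_monomial lookup_squarefree_monomial)

lemma prod_mult_prod_eq_powers:
  fixes y :: "'v \<Rightarrow> real"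
  assumes J: "finite J" and E: "E \<subseteq> J" "F \<subseteq> J"
  shows "(\<Prod>e\<in>E. y e) * (\<Prod>e\<in>F. y e) = (\<Prod>e\<in>J. y e ^ (of_bool (e \<in> E) + of_bool (e \<in> F)))"
proof -
  have "(\<Prod>e\<in>E. y e) = (\<Prod>e\<in>J. y e ^ of_bool (e \<in> E))" if "E \<subseteq> J" for E
    using J that by (simp add: of_bool_def if_distrib prod.If_cases Int_absorb1 cong: if_cong)
  with E show ?thesis by (simp add: power_add prod.distrib)
qed

text \<open>An index in exactly one of \<open>E\<close> and \<open>F\<close> contributes the mean of
  a centred Gaussian, which is 0. If \<open>E = F\<close>, every exponent is 0 or 2 and the
  variances remain.\<close>

lemma integral_gaussian_prod_mult_prod:
  fixes v :: "'v \<Rightarrow> real"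
  assumes J: "finite J" and v: "\<And>e. e \<in> J \<Longrightarrow> 0 < v e" and E: "E \<subseteq> J" "F \<subseteq> J"
  shows "integrable (PiM J (\<lambda>e. gaussian 0 (v e))) (\<lambda>y. (\<Prod>e\<in>E. y e) * (\<Prod>e\<in>F. y e))"
    and "(\<integral>y. (\<Prod>e\<in>E. y e) * (\<Prod>e\<in>F. y e) \<partial>PiM J (\<lambda>e. gaussian 0 (v e))) =
      (if E = F then \<Prod>e\<in>E. v e else 0)"
proof -
  let ?k = "\<lambda>e. of_bool (e \<in> E) + of_bool (e \<in> F) :: nat"
  have G: "prob_space (gaussian 0 (v e))" if "e \<in> J" for e
    using v[OF that] by (rule prob_space_gaussian)
  have mom: "integrable (gaussian 0 (v e)) (\<lambda>y. y ^ ?k e)"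
    "(\<integral>y. y ^ ?k e \<partial>gaussian 0 (v e)) =
      (if e \<in> E \<and> e \<in> F then v e else if e \<in> E \<or> e \<in> F then 0 else 1)" if "e \<in> J" for e
  proof -
    have k: "?k e \<le> 2" by simp
    show "integrable (gaussian 0 (v e)) (\<lambda>y. y ^ ?k e)"
      using v[OF that] k by (rule gaussian_moment_le_2)
    show "(\<integral>y. y ^ ?k e \<partial>gaussian 0 (v e)) =
        (if e \<in> E \<and> e \<in> F then v e else if e \<in> E \<or> e \<in> F then 0 else 1)"
      unfolding gaussian_moment_le_2(2)[OF v[OF that] k] by simp
  qed
  show "integrable (PiM J (\<lambda>e. gaussian 0 (v e))) (\<lambda>y. (\<Prod>e\<in>E. y e) * (\<Prod>e\<in>F. y e))"
    unfolding prod_mult_prod_eq_powers[OF J E] using J G mom(1) by (rule integral_PiM_prod)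
  have "(\<integral>y. (\<Prod>e\<in>E. y e) * (\<Prod>e\<in>F. y e) \<partial>PiM J (\<lambda>e. gaussian 0 (v e))) =
      (\<Prod>e\<in>J. \<integral>y. y ^ ?k e \<partial>gaussian 0 (v e))"
    unfolding prod_mult_prod_eq_powers[OF J E] using J G mom(1) by (rule integral_PiM_prod)
  also have "\<dots> = (\<Prod>e\<in>J. if e \<in> E \<and> e \<in> F then v e else if e \<in> E \<or> e \<in> F then 0 else 1)"
    by (intro prod.cong refl mom(2))
  also have "\<dots> = (if E = F then \<Prod>e\<in>E. v e else 0)"
  proof (cases "E = F")
    case True
    with J E show ?thesis by (simp add: prod.If_cases Int_absorb1)
  next
    case False
    then obtain e where "e \<in> E \<and> e \<notin> F \<or> e \<in> F \<and> e \<notin> E" by blast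
    then have "e \<in> J" "(if e \<in> E \<and> e \<in> F then v e else if e \<in> E \<or> e \<in> F then 0 else 1) = 0"
      using E by auto
    then have "(\<Prod>e\<in>J. if e \<in> E \<and> e \<in> F then v e else if e \<in> E \<or> e \<in> F then 0 else 1) = 0"
      by (intro prod_zero[OF J] bexI[of _ e])
    with False show ?thesis by simp
  qed
  finally show "(\<integral>y. (\<Prod>e\<in>E. y e) * (\<Prod>e\<in>F. y e) \<partial>PiM J (\<lambda>e. gaussian 0 (v e))) =
      (if E = F then \<Prod>e\<in>E. v e else 0)" .
qed

text \<open>The weights \<open>1 / Var\<close> make the numerator \<open>(\<mu> S)^2\<close> and the denominator \<open>S\<close>.\<close>

lemma chi2_lowdeg_squarefree_ge:
  fixes v :: "'v \<Rightarrow> real" and \<E> :: "'v set set"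
  defines "S \<equiv> (\<Sum>E\<in>\<E>. \<Prod>e\<in>E. 1 / v e)"
  assumes J: "finite J" and v: "\<And>e. e \<in> J \<Longrightarrow> 0 < v e"
    and \<E>: "\<And>E. E \<in> \<E> \<Longrightarrow> E \<subseteq> J \<and> card E \<le> D"
    and int: "\<And>E. E \<in> \<E> \<Longrightarrow> integrable P (\<lambda>y. \<Prod>e\<in>E. y e)"
    and mean: "\<And>E. E \<in> \<E> \<Longrightarrow> (\<integral>y. (\<Prod>e\<in>E. y e) \<partial>P) = \<mu>"
    and pos: "0 < S" "\<mu> \<noteq> 0"
  shows "ereal (\<mu>\<^sup>2 * S - 1) \<le> chi2_lowdeg J D P (PiM J (\<lambda>e. gaussian 0 (v e)))"
proof -
  let ?Q = "PiM J (\<lambda>e. gaussian 0 (v e))"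
  define c where "c E = (\<Prod>e\<in>E. 1 / v e)" for E
  define f where "f = squarefree_poly \<E> c"
  have sub: "E \<subseteq> J" if "E \<in> \<E>" for E using \<E>[OF that] by simp
  have fin: "finite \<E>" by (rule finite_subset[of _ "Pow J"]) (use sub J in auto)
  have fin_E: "finite E" if "E \<in> \<E>" for E using sub[OF that] J by (rule finite_subset)
  have eval: "poly_eval f y = (\<Sum>E\<in>\<E>. c E * (\<Prod>e\<in>E. y e))" for y
    unfolding f_def using fin fin_E by (rule poly_eval_squarefree_poly)
  have "(\<integral>y. poly_eval f y \<partial>P) = (\<Sum>E\<in>\<E>. c E * \<mu>)"
    unfolding eval using int mean by (subst Bochner_Integration.integral_sum) auto
  also have "\<dots> = \<mu> * S"
    by (simp add: S_def c_def sum_distrib_left mult.commute)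
  finally have P: "(\<integral>y. poly_eval f y \<partial>P) = \<mu> * S" .
  have "(\<integral>y. (poly_eval f y)\<^sup>2 \<partial>?Q) =
      (\<integral>y. (\<Sum>E\<in>\<E>. \<Sum>F\<in>\<E>. (c E * c F) * ((\<Prod>e\<in>E. y e) * (\<Prod>e\<in>F. y e))) \<partial>?Q)"
    by (simp add: eval power2_eq_square sum_product mult_ac)
  also have "\<dots> = (\<Sum>E\<in>\<E>. \<Sum>F\<in>\<E>. (c E * c F) * (\<integral>y. (\<Prod>e\<in>E. y e) * (\<Prod>e\<in>F. y e) \<partial>?Q))"
  proof -
    have "integrable ?Q (\<lambda>y. (c E * c F) * ((\<Prod>e\<in>E. y e) * (\<Prod>e\<in>F. y e)))"
      if "E \<in> \<E>" "F \<in> \<E>" for E F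
      using integral_gaussian_prod_mult_prod(1)[OF J v sub[OF that(1)] sub[OF that(2)]]
      by (intro integrable_mult_right) auto
    then show ?thesis
      by (subst Bochner_Integration.integral_sum, fastforce intro!: Bochner_Integration.integrable_sum,
          intro sum.cong refl, subst Bochner_Integration.integral_sum) auto
  qed
  also have "\<dots> = (\<Sum>E\<in>\<E>. \<Sum>F\<in>\<E>. if E = F then c E * c F * (\<Prod>e\<in>E. v e) else 0)"
    using integral_gaussian_prod_mult_prod(2)[OF J v sub sub] by (intro sum.cong refl) auto
  \<comment> \<open>Only the diagonal survives, and there the product of the variances cancels one
    of the two factors \<open>c E\<close>.\<close>
  also have "\<dots> = (\<Sum>E\<in>\<E>. c E)"
  proof (intro sum.cong refl)
    fix E assume E: "E \<in> \<E>"
    have "c E * (\<Prod>e\<in>E. v e) = (\<Prod>e\<in>E. 1)"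
      unfolding c_def prod.distrib[symmetric] using v sub[OF E] by (intro prod.cong) force+
    then show "(\<Sum>F\<in>\<E>. if E = F then c E * c F * (\<Prod>e\<in>E. v e) else 0) = c E"
      using fin E by simp
  qed
  finally have Q: "(\<integral>y. (poly_eval f y)\<^sup>2 \<partial>?Q) = S" by (simp add: S_def c_def)
  \<comment> \<open>The polynomial is nonzero because its planted mean \<open>\<mu> * S\<close>
    is.\<close>
  have "f \<noteq> 0"
  proof
    assume "f = 0"
    then have "poly_eval f y = 0" for y by (simp add: poly_eval_def)
    with P pos show False by simp
  qed
  moreover have "f \<in> polys_upto J D"
    unfolding f_def using \<E> fin_E by (intro squarefree_poly_in_polys_upto) auto
  ultimately have "ereal ((\<mu> * S)\<^sup>2 / S) \<le>
      (SUP f \<in> polys_upto J D - {0}. ereal ((\<integral>y. poly_eval f y \<partial>P)\<^sup>2 / (\<integral>y. (poly_eval f y)\<^sup>2 \<partial>?Q)))"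
    unfolding P[symmetric] by (subst Q[symmetric]) (intro SUP_upper, simp)
  then have "ereal ((\<mu> * S)\<^sup>2 / S) - 1 \<le> chi2_lowdeg J D P ?Q"
    unfolding chi2_lowdeg_def by (intro ereal_minus_mono) auto
  moreover have "(\<mu> * S)\<^sup>2 / S = \<mu>\<^sup>2 * S"
    using pos by (simp add: power2_eq_square)
  ultimately show ?thesis by (simp add: one_ereal_def)
qed

section \<open>The planted law\<close>

lemma gaussian_obs_eq:
  "gaussian_obs N \<Delta> x = PiM (observed N \<Delta>) (\<lambda>e. gaussian (x e) (real_of_ereal (\<Delta> (fst e) (snd e))))"
proof -
  have "(\<lambda>(i, j). gaussian (x (i, j)) (real_of_ereal (\<Delta> i j))) =
      (\<lambda>e. gaussian (x e) (real_of_ereal (\<Delta> (fst e) (snd e))))"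
    by (simp add: fun_eq_iff)
  then show ?thesis by (simp only: gaussian_obs_def)
qed

lemma observed_subset: "observed N \<Delta> \<subseteq> {1..N} \<times> {1..N}"
  by (auto simp: observed_def)

lemma finite_observed: "finite (observed N \<Delta>)"
  using observed_subset by (rule finite_subset) simp

text \<open>Given the signal, the entries are independent with means \<open>x e\<close>, so the
  conditional mean of the product is the product of the signal entries. The almost sure bound
  \<open>C\<close> makes the conditional absolute moments uniformly bounded, as required for
  exchanging the integrals.\<close>

lemma integral_planted_law_prod:
  assumes \<X>: "prob_space \<X>" "sets \<X> = sets (PiM ({1..N} \<times> {1..N}) (\<lambda>_. borel))"
    and bdd: "AE x in \<X>. \<forall>e\<in>observed N \<Delta>. \<bar>x e\<bar> \<le> C"
    and v: "\<And>e. e \<in> observed N \<Delta> \<Longrightarrow> 0 < real_of_ereal (\<Delta> (fst e) (snd e))"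
    and E: "E \<subseteq> observed N \<Delta>"
  shows "integrable (planted_law N \<Delta> \<X>) (\<lambda>y. \<Prod>e\<in>E. y e)"
    and "(\<integral>y. (\<Prod>e\<in>E. y e) \<partial>planted_law N \<Delta> \<X>) = (\<integral>x. (\<Prod>e\<in>E. x e) \<partial>\<X>)"
proof -
  let ?J = "observed N \<Delta>" and ?v = "\<lambda>e. real_of_ereal (\<Delta> (fst e) (snd e))"
  let ?f = "\<lambda>y. \<Prod>e\<in>E. y e :: real"
  interpret \<X>: prob_space \<X> by (rule \<X>(1))
  note J = finite_observed[of N \<Delta>]
  have G: "prob_space (gaussian (x e) (?v e))" if "e \<in> ?J" for x e
    using v[OF that] by (rule prob_space_gaussian)
  have K: "gaussian_obs N \<Delta> \<in> \<X> \<rightarrow>\<^sub>M subprob_algebra (PiM ?J (\<lambda>_. borel))"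
    unfolding gaussian_obs_eq measurable_cong_sets[OF \<X>(2) refl]
    using J observed_subset v by (rule measurable_PiM_gaussian)
  have f: "?f \<in> borel_measurable (PiM ?J (\<lambda>_. borel))"
    using E by (intro borel_measurable_prod) (auto intro!: measurable_component_singleton)
  have id: "inj_on id E" "id ` E \<subseteq> ?J" using E by auto
  have vE: "0 < ?v e" if "e \<in> E" for e using v E that by blast
  have prod_g: "integrable (gaussian_obs N \<Delta> x) (\<lambda>y. \<Prod>e\<in>E. g (y e))"
      "(\<integral>y. (\<Prod>e\<in>E. g (y e)) \<partial>gaussian_obs N \<Delta> x) = (\<Prod>e\<in>E. \<integral>y. g y \<partial>gaussian (x e) (?v e))"
    if g: "\<And>e. e \<in> E \<Longrightarrow> integrable (gaussian (x e) (?v e)) g" for g :: "real \<Rightarrow> real" and x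
    using integral_PiM_prod_inj[of ?J "\<lambda>e. gaussian (x e) (?v e)" id E "\<lambda>_. g", OF J G[of _ x] id] g
    by (simp_all add: gaussian_obs_eq)
  have prod_f: "integrable (gaussian_obs N \<Delta> x) ?f" "(\<integral>y. ?f y \<partial>gaussian_obs N \<Delta> x) = ?f x" for x
    using prod_g[of x "\<lambda>y. y", OF gaussian_mean(1)[OF vE]] gaussian_mean(2)[OF vE] by simp_all
  define B where "B = (\<Prod>e\<in>E. C + sqrt (?v e) * sqrt (2 / pi))"
  have abs_le: "(\<integral>\<^sup>+y. ennreal \<bar>?f y\<bar> \<partial>gaussian_obs N \<Delta> x) \<le> ennreal B" if x: "\<forall>e\<in>?J. \<bar>x e\<bar> \<le> C" for x
  proof -
    have "(\<integral>\<^sup>+y. ennreal \<bar>?f y\<bar> \<partial>gaussian_obs N \<Delta> x) = ennreal (\<integral>y. \<bar>?f y\<bar> \<partial>gaussian_obs N \<Delta> x)"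
      using prod_f(1)[of x] by (intro nn_integral_eq_integral integrable_abs) auto
    also have "(\<integral>y. \<bar>?f y\<bar> \<partial>gaussian_obs N \<Delta> x) = (\<Prod>e\<in>E. \<integral>y. \<bar>y\<bar> \<partial>gaussian (x e) (?v e))"
      using prod_g(2)[of x "\<lambda>y. \<bar>y\<bar>", OF gaussian_abs_moment_le(1)[OF vE]] by (simp add: abs_prod)
    also have "\<dots> \<le> B"
      unfolding B_def
    proof (intro prod_mono conjI)
      fix e assume "e \<in> E"
      then have e: "e \<in> ?J" using E by auto
      show "0 \<le> (\<integral>y. \<bar>y\<bar> \<partial>gaussian (x e) (?v e))" by simp
      show "(\<integral>y. \<bar>y\<bar> \<partial>gaussian (x e) (?v e)) \<le> C + sqrt (?v e) * sqrt (2 / pi)"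
        using gaussian_abs_moment_le(2)[OF v[OF e], of "x e"] bspec[OF x e] by linarith
    qed
    finally show ?thesis by (simp add: ennreal_leI)
  qed
  have "(\<integral>\<^sup>+x. \<integral>\<^sup>+y. ennreal \<bar>?f y\<bar> \<partial>gaussian_obs N \<Delta> x \<partial>\<X>) \<le> (\<integral>\<^sup>+x. ennreal B \<partial>\<X>)"
    using bdd by (intro nn_integral_mono_AE) (auto elim!: eventually_mono intro: abs_le)
  also have "\<dots> < \<infinity>" by (simp add: \<X>.emeasure_space_1)
  finally have fin: "(\<integral>\<^sup>+x. \<integral>\<^sup>+y. ennreal \<bar>?f y\<bar> \<partial>gaussian_obs N \<Delta> x \<partial>\<X>) < \<infinity>" .
  show "integrable (planted_law N \<Delta> \<X>) ?f"
    unfolding planted_law_def using \<X>.not_empty K f fin by (rule integral_bind_kernel)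
  show "(\<integral>y. ?f y \<partial>planted_law N \<Delta> \<X>) = (\<integral>x. ?f x \<partial>\<X>)"
    unfolding planted_law_def integral_bind_kernel(2)[OF \<X>.not_empty K f fin] prod_f(2) ..
qed

section \<open>Bounded rows and cycle moments of the signal\<close>

lemma AE_norm_le_of_bounded_support:
  fixes \<nu> :: "'a::euclidean_space measure"
  assumes "sets \<nu> = sets borel" "bounded (support \<nu>)"
  obtains B where "0 \<le> B" "AE x in \<nu>. norm x \<le> B"
proof -
  obtain B where "\<forall>x\<in>support \<nu>. norm x \<le> B"
    using assms(2) by (auto simp: bounded_iff)
  then have "AE x in \<nu>. norm x \<le> \<bar>B\<bar>"
    using AE_in_support[OF assms(1)] by (auto elim!: eventually_mono)
  then show ?thesis using that[of "\<bar>B\<bar>"] by simp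
qed

text \<open>The measure lives on a closed ball, which is compact, so \<open>f\<close> is almost
  surely bounded.\<close>

lemma integrable_continuous_bounded_support:
  fixes f :: "'a::euclidean_space \<Rightarrow> 'b::{banach, second_countable_topology}"
  assumes \<nu>: "prob_space \<nu>" "sets \<nu> = sets borel" "bounded (support \<nu>)"
    and f: "continuous_on UNIV f"
  shows "integrable \<nu> f"
proof -
  interpret prob_space \<nu> by (rule \<nu>(1))
  obtain B where B: "AE x in \<nu>. norm x \<le> B"
    using AE_norm_le_of_bounded_support[OF \<nu>(2,3)] by blast
  have "bounded (f ` cball 0 B)"
    using continuous_on_subset[OF f] by (intro compact_imp_bounded compact_continuous_image) auto
  then obtain C where "\<forall>x\<in>cball 0 B. norm (f x) \<le> C"
    by (auto simp: bounded_iff)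
  with B have "AE x in \<nu>. norm (f x) \<le> C"
    by (auto elim!: eventually_mono)
  moreover have "f \<in> borel_measurable \<nu>"
    using borel_measurable_continuous_onI[OF f] measurable_cong_sets[OF \<nu>(2) refl] by blast
  ultimately show ?thesis by (rule integrable_const_bound)
qed

lemma second_moment_nth:
  fixes \<nu> :: "(real ^ 'k) measure"
  assumes \<nu>: "prob_space \<nu>" "sets \<nu> = sets borel" "bounded (support \<nu>)"
  shows "second_moment \<nu> $ a $ b = (\<integral>x. x $ a * x $ b \<partial>\<nu>)"
proof -
  have "integrable \<nu> (\<lambda>x. outer x x)"
    unfolding outer_def
    by (intro integrable_continuous_bounded_support[OF \<nu>] continuous_intros)
  then have "(\<integral>x. outer x x $ a $ b \<partial>\<nu>) = second_moment \<nu> $ a $ b"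
    unfolding second_moment_def
    by (intro integral_bounded_linear bounded_linear_compose[OF bounded_linear_vec_nth bounded_linear_vec_nth])
  then show ?thesis by (simp add: outer_def)
qed

lemma transpose_second_moment:
  fixes \<nu> :: "(real ^ 'k) measure"
  assumes \<nu>: "prob_space \<nu>" "sets \<nu> = sets borel" "bounded (support \<nu>)"
  shows "transpose (second_moment \<nu>) = second_moment \<nu>"
  by (simp add: vec_eq_iff transpose_def second_moment_nth[OF \<nu>] mult.commute)

lemma inj_on_Suc_mod: "inj_on (\<lambda>i. Suc i mod L) {..<L}"
  by (rule inj_onI) (auto simp: mod_Suc split: if_splits)

text \<open>Expand each inner product over a coordinate \<open>c i\<close>. Every row occurs in
  exactly two consecutive inner products, and rows at distinct vertices are independent, so the
  expectation factors into second moments along the closed walk \<open>c\<close>.\<close>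

lemma integral_factor_law_cycle:
  fixes \<nu> :: "(real ^ 'k) measure"
  assumes \<nu>: "prob_space \<nu>" "sets \<nu> = sets borel" "bounded (support \<nu>)"
    and w: "w \<in> cycles L {1..N}"
  shows "(\<integral>V. (\<Prod>i<L. V (w i) \<bullet> V (w (Suc i mod L))) \<partial>factor_law \<nu> N) =
    cycle_sum L (\<lambda>a b. second_moment \<nu> $ a $ b) UNIV"
proof -
  let ?s = "\<lambda>i. Suc i mod L" and ?C = "{..<L} \<rightarrow>\<^sub>E (UNIV :: 'k set)"
  have inj: "inj_on (\<lambda>i. w (?s i)) {..<L}"
  proof -
    have "?s ` {..<L} \<subseteq> {..<L}" by auto
    then have "inj_on w (?s ` {..<L})"
      using w by (auto simp: cycles_def intro: inj_on_subset)
    then show ?thesis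
      using comp_inj_on[OF inj_on_Suc_mod, of w L] by (simp add: o_def)
  qed
  have range: "(\<lambda>i. w (?s i)) ` {..<L} \<subseteq> {1..N}"
    using w by (auto simp: cycles_def PiE_iff)
  \<comment> \<open>The first factors are shifted cyclically so that both coordinates of the same
    row stand together.\<close>
  have expand: "(\<Prod>i<L. V (w i) \<bullet> V (w (?s i))) =
      (\<Sum>c\<in>?C. \<Prod>i<L. V (w (?s i)) $ c (?s i) * V (w (?s i)) $ c i)" for V :: "nat \<Rightarrow> real ^ 'k"
  proof -
    have "(\<Prod>i<L. V (w i) \<bullet> V (w (?s i))) = (\<Sum>c\<in>?C. \<Prod>i<L. V (w i) $ c i * V (w (?s i)) $ c i)"
      unfolding inner_vec_def inner_real_def by (rule prod_sum_PiE) auto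
    also have "\<dots> = (\<Sum>c\<in>?C. \<Prod>i<L. V (w (?s i)) $ c (?s i) * V (w (?s i)) $ c i)"
      unfolding prod.distrib using prod_Suc_mod[of "\<lambda>i. V (w i) $ _ i" L]
      by (intro sum.cong refl) simp
    finally show ?thesis .
  qed
  have int: "integrable \<nu> (\<lambda>x. x $ a * x $ b)" for a b
    by (intro integrable_continuous_bounded_support[OF \<nu>] continuous_intros)
  have prod: "integrable (factor_law \<nu> N) (\<lambda>V. \<Prod>i<L. V (w (?s i)) $ c (?s i) * V (w (?s i)) $ c i)"
    "(\<integral>V. (\<Prod>i<L. V (w (?s i)) $ c (?s i) * V (w (?s i)) $ c i) \<partial>factor_law \<nu> N) =
      (\<Prod>i<L. second_moment \<nu> $ c i $ c (?s i))" for c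
    using integral_PiM_prod_inj[of "{1..N}" "\<lambda>_. \<nu>" "\<lambda>i. w (?s i)" "{..<L}" "\<lambda>i x. x $ c (?s i) * x $ c i"]
      \<nu>(1) inj range int
    by (simp_all add: factor_law_def second_moment_nth[OF \<nu>] mult.commute)
  show ?thesis
    unfolding expand cycle_sum_def using prod by (subst Bochner_Integration.integral_sum) auto
qed

lemma measurable_signal:
  fixes \<nu> :: "(real ^ 'k) measure"
  assumes "sets \<nu> = sets borel"
  shows "(\<lambda>V. \<lambda>(i, j)\<in>{1..N} \<times> {1..N}. \<beta> / sqrt (real N) * (V i \<bullet> V j)) \<in>
    factor_law \<nu> N \<rightarrow>\<^sub>M PiM ({1..N} \<times> {1..N}) (\<lambda>_. borel)"
proof (rule measurable_restrict)
  fix e :: "nat \<times> nat" assume e: "e \<in> {1..N} \<times> {1..N}"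
  have comp: "(\<lambda>V. V i) \<in> borel_measurable (factor_law \<nu> N)" if "i \<in> {1..N}" for i
    using measurable_component_singleton[OF that, of "\<lambda>_. \<nu>"] measurable_cong_sets[OF refl assms]
    unfolding factor_law_def by blast
  obtain i j where ij: "e = (i, j)" "i \<in> {1..N}" "j \<in> {1..N}" using e by auto
  show "(\<lambda>V. case e of (i, j) \<Rightarrow> \<beta> / sqrt (real N) * (V i \<bullet> V j)) \<in> borel_measurable (factor_law \<nu> N)"
    unfolding ij(1) prod.case
    by (intro borel_measurable_times borel_measurable_const borel_measurable_inner comp ij)
qed

text \<open>Symmetry of the Gram matrix makes the ordering inside \<open>edge\<close>
  harmless.\<close>

lemma signal_edge:
  assumes "a \<in> {1..N}" "b \<in> {1..N}"
  shows "(\<lambda>(i, j)\<in>{1..N} \<times> {1..N}. c * (V i \<bullet> V j)) (edge a b) = c * (V a \<bullet> V b)"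
  using assms by (auto simp: edge_def min_def max_def inner_commute)

text \<open>The edges of a cycle are distinct, so the product over the edge set is the product over
  positions, and the scale \<open>\<beta> / sqrt (real N)\<close> comes out once per edge.\<close>

lemma integral_signal_law_cycle:
  fixes \<nu> :: "(real ^ 'k) measure"
  assumes \<nu>: "prob_space \<nu>" "sets \<nu> = sets borel" "bounded (support \<nu>)"
    and L: "3 \<le> L" and w: "w \<in> cycles L {1..N}"
  shows "(\<integral>x. (\<Prod>e\<in>cycle_edge L w ` {..<L}. x e) \<partial>signal_law \<beta> \<nu> N) =
    (\<beta> / sqrt (real N)) ^ L * cycle_sum L (\<lambda>a b. second_moment \<nu> $ a $ b) UNIV"
proof -
  let ?I = "{1..N} \<times> {1..N}"
  let ?X = "\<lambda>V. \<lambda>(i, j)\<in>?I. \<beta> / sqrt (real N) * (V i \<bullet> V j)"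
  have wN: "w i \<in> {1..N}" if "i < L" for i using w that by (auto simp: cycles_def PiE_iff)
  then have s: "w i \<in> {1..N}" "w (Suc i mod L) \<in> {1..N}" if "i < L" for i
    using that by auto
  have E: "cycle_edge L w ` {..<L} \<subseteq> ?I"
    using s by (force simp: cycle_edge_def edge_def min_def max_def)
  have inj: "inj_on (cycle_edge L w) {..<L}"
    using L w by (intro inj_on_cycle_edge) (auto simp: cycles_def)
  have "(\<integral>x. (\<Prod>e\<in>cycle_edge L w ` {..<L}. x e) \<partial>signal_law \<beta> \<nu> N) =
      (\<integral>V. (\<Prod>e\<in>cycle_edge L w ` {..<L}. ?X V e) \<partial>factor_law \<nu> N)"
    unfolding signal_law_def
    using E by (intro integral_distr measurable_signal \<nu> borel_measurable_prod measurable_component_singleton) auto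
  also have "(\<lambda>V :: nat \<Rightarrow> real ^ 'k. \<Prod>e\<in>cycle_edge L w ` {..<L}. ?X V e) =
      (\<lambda>V. (\<beta> / sqrt (real N)) ^ L * (\<Prod>i<L. V (w i) \<bullet> V (w (Suc i mod L))))"
  proof
    fix V :: "nat \<Rightarrow> real ^ 'k"
    have "(\<Prod>e\<in>cycle_edge L w ` {..<L}. ?X V e) = (\<Prod>i<L. ?X V (cycle_edge L w i))"
      by (simp only: prod.reindex[OF inj] o_def)
    also have "\<dots> = (\<Prod>i<L. \<beta> / sqrt (real N) * (V (w i) \<bullet> V (w (Suc i mod L))))"
      unfolding cycle_edge_def by (intro prod.cong refl signal_edge s) auto
    finally show "(\<Prod>e\<in>cycle_edge L w ` {..<L}. ?X V e) =
      (\<beta> / sqrt (real N)) ^ L * (\<Prod>i<L. V (w i) \<bullet> V (w (Suc i mod L)))"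
      by (simp only: prod.distrib prod_constant card_lessThan)
  qed
  also have "(\<integral>V. (\<beta> / sqrt (real N)) ^ L * (\<Prod>i<L. V (w i) \<bullet> V (w (Suc i mod L))) \<partial>factor_law \<nu> N) =
    (\<beta> / sqrt (real N)) ^ L * cycle_sum L (\<lambda>a b. second_moment \<nu> $ a $ b) UNIV"
    using integral_factor_law_cycle[OF \<nu> w] by simp
  finally show ?thesis .
qed

lemma prob_space_signal_law:
  fixes \<nu> :: "(real ^ 'k) measure"
  assumes "prob_space \<nu>" "sets \<nu> = sets borel"
  shows "prob_space (signal_law \<beta> \<nu> N)"
proof -
  interpret prob_space "factor_law \<nu> N"
    unfolding factor_law_def using assms(1) by (intro prob_space_PiM)
  show ?thesis
    unfolding signal_law_def by (rule prob_space_distr[OF measurable_signal[OF assms(2)]])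
qed

lemma AE_signal_law_bounded:
  fixes \<nu> :: "(real ^ 'k) measure"
  assumes \<nu>: "prob_space \<nu>" "sets \<nu> = sets borel" "bounded (support \<nu>)"
  obtains C where "AE x in signal_law \<beta> \<nu> N. \<forall>e\<in>{1..N} \<times> {1..N}. \<bar>x e\<bar> \<le> C"
proof -
  let ?I = "{1..N} \<times> {1..N}"
  obtain B where B: "0 \<le> B" "AE x in \<nu>. norm x \<le> B"
    using AE_norm_le_of_bounded_support[OF \<nu>(2,3)] by blast
  have "AE V in factor_law \<nu> N. \<forall>i\<in>{1..N}. norm (V i) \<le> B"
    unfolding factor_law_def
    using \<nu>(1) B(2) by (intro AE_finite_allI) (auto intro!: AE_PiM_component[where P="\<lambda>x. norm x \<le> B"])
  then have *: "AE V in factor_law \<nu> N. \<forall>e\<in>?I.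
      \<bar>(\<lambda>(i, j)\<in>?I. \<beta> / sqrt (real N) * (V i \<bullet> V j)) e\<bar> \<le> \<bar>\<beta> / sqrt (real N)\<bar> * (B * B)"
  proof eventually_elim
    case (elim V)
    show ?case
    proof
      fix e assume "e \<in> ?I"
      then obtain i j where e: "e = (i, j)" "i \<in> {1..N}" "j \<in> {1..N}" by auto
      have "\<bar>V i \<bullet> V j\<bar> \<le> norm (V i) * norm (V j)" by (rule Cauchy_Schwarz_ineq2)
      also have "\<dots> \<le> B * B" using elim e B(1) by (intro mult_mono) auto
      finally have "\<bar>\<beta> / sqrt (real N)\<bar> * \<bar>V i \<bullet> V j\<bar> \<le> \<bar>\<beta> / sqrt (real N)\<bar> * (B * B)"
        by (intro mult_left_mono) auto
      then show "\<bar>(\<lambda>(i, j)\<in>?I. \<beta> / sqrt (real N) * (V i \<bullet> V j)) e\<bar> \<le> \<bar>\<beta> / sqrt (real N)\<bar> * (B * B)"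
        using e by (simp add: abs_mult)
    qed
  qed
  have "AE x in signal_law \<beta> \<nu> N. \<forall>e\<in>?I. \<bar>x e\<bar> \<le> \<bar>\<beta> / sqrt (real N)\<bar> * (B * B)"
    unfolding signal_law_def
  proof (subst AE_distr_iff[OF measurable_signal[OF \<nu>(2)]])
    show "{x \<in> space (PiM ?I (\<lambda>_. borel :: real measure)). \<forall>e\<in>?I. \<bar>x e\<bar> \<le> \<bar>\<beta> / sqrt (real N)\<bar> * (B * B)}
        \<in> sets (PiM ?I (\<lambda>_. borel))"
      by measurable
  qed (rule *)
  then show ?thesis by (rule that)
qed

section \<open>Block-structured profiles\<close>

text \<open>For an infinite variance both sides are 0: \<open>real_of_ereal\<close> sends
  \<infinity> to 0, and real division by 0 gives 0. Unobserved entries thus have weight 0.\<close>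

lemma reciprocal_nth:
  assumes "0 < \<Delta>bar $ a $ b"
  shows "reciprocal \<Delta>bar $ a $ b = 1 / real_of_ereal (\<Delta>bar $ a $ b)"
  using assms by (cases "\<Delta>bar $ a $ b") (auto simp: reciprocal_def one_ereal_def)

text \<open>Bound at a fixed size \<open>N\<close> from the polynomial of observed
  \<open>L\<close>-cycles. The planted mean contributes \<open>N ^ L\<close> in the denominator of
  its square, and the number of cycles contributes \<open>N ^ L\<close> to \<open>S\<close>; these
  powers cancel.\<close>

lemma chi2_lowdeg_block_ge:
  fixes \<Delta>bar :: "ereal ^ 'n ^ 'n" and \<nu> :: "(real ^ 'k) measure" and q :: "nat \<Rightarrow> 'n"
  defines "\<Phi> \<equiv> reciprocal \<Delta>bar"
    and "t \<equiv> \<lambda>L. cycle_sum L (\<lambda>a b. second_moment \<nu> $ a $ b) UNIV"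
  assumes \<nu>: "prob_space \<nu>" "sets \<nu> = sets borel" "bounded (support \<nu>)"
    and \<Delta>: "\<And>i j. i \<in> {1..N} \<Longrightarrow> j \<in> {1..N} \<Longrightarrow> \<Delta> i j = \<Delta>bar $ q i $ q j"
    and pos: "\<And>a b. 0 < \<Delta>bar $ a $ b" and sym: "transpose \<Delta>bar = \<Delta>bar"
    and L: "3 \<le> L" "L \<le> D" and N: "0 < N" and \<beta>: "0 < \<beta>" and t: "t L \<noteq> 0" and K: "0 \<le> K"
    and sum: "K * real N ^ L < (\<Sum>w\<in>cycles L {1..N}. \<Prod>i<L. \<Phi> $ q (w i) $ q (w (Suc i mod L)))"
  shows "ereal (\<beta> ^ (2 * L) * (t L)\<^sup>2 * (K / (2 * real L)) - 1) \<le>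
    chi2_lowdeg (observed N \<Delta>) D (planted_law N \<Delta> (signal_law \<beta> \<nu> N)) (null_law N \<Delta>)"
proof -
  let ?J = "observed N \<Delta>" and ?P = "planted_law N \<Delta> (signal_law \<beta> \<nu> N)"
  let ?v = "\<lambda>e. real_of_ereal (\<Delta> (fst e) (snd e))"
  let ?e = "\<lambda>w. cycle_edge L w ` {..<L}"
  have sym': "\<Delta>bar $ a $ b = \<Delta>bar $ b $ a" for a b
    using sym unfolding transpose_def by (metis vec_lambda_beta)
  have \<Phi>_nonneg: "0 \<le> \<Phi> $ a $ b" for a b
    unfolding \<Phi>_def reciprocal_nth[OF pos] using pos[of a b] by (simp add: real_of_ereal_pos)
  have v: "0 < ?v e" if "e \<in> ?J" for e
  proof -
    obtain i j where e: "e = (i, j)" by (cases e)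
    with that have "\<Delta> i j = \<Delta>bar $ q i $ q j" "\<Delta> i j \<noteq> \<infinity>"
      by (auto simp: observed_def intro!: \<Delta>)
    with pos[of "q i" "q j"] e show ?thesis by (cases "\<Delta>bar $ q i $ q j") auto
  qed
  have \<Delta>_edge: "\<Delta> (fst (edge a b)) (snd (edge a b)) = \<Delta>bar $ q a $ q b"
    if "a \<in> {1..N}" "b \<in> {1..N}" for a b
    using that \<Delta>[OF that] \<Delta>[OF that(2,1)] sym' by (simp add: edge_def min_def max_def)
  define W where "W = {w \<in> cycles L {1..N}. ?e w \<subseteq> ?J}"
  define S where "S = (\<Sum>E\<in>?e ` W. \<Prod>e\<in>E. 1 / ?v e)"
  have in_N: "w i \<in> {1..N}" "w (Suc i mod L) \<in> {1..N}" if "w \<in> cycles L {1..N}" "i < L" for w i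
    using that by (auto simp: cycles_def PiE_iff)
  have inj: "inj_on (cycle_edge L w) {..<L}" if "w \<in> cycles L {1..N}" for w
    using that L by (intro inj_on_cycle_edge) (auto simp: cycles_def)
  have weight: "(\<Prod>e\<in>?e w. 1 / ?v e) = (\<Prod>i<L. \<Phi> $ q (w i) $ q (w (Suc i mod L)))"
    if w: "w \<in> cycles L {1..N}" for w
    unfolding prod.reindex[OF inj[OF w]] o_def
    using in_N[OF w] by (intro prod.cong refl)
      (simp only: cycle_edge_def \<Delta>_edge \<Phi>_def reciprocal_nth[OF pos] lessThan_iff)
  \<comment> \<open>An unobserved edge has weight 0, so restricting the sum to \<open>W\<close>
    loses nothing.\<close>
  have unobserved: "(\<Prod>i<L. \<Phi> $ q (w i) $ q (w (Suc i mod L))) = 0"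
    if w: "w \<in> cycles L {1..N}" "\<not> ?e w \<subseteq> ?J" for w
  proof -
    from w(2) obtain i where i: "i < L" "cycle_edge L w i \<notin> ?J" by blast
    then have "\<Delta>bar $ q (w i) $ q (w (Suc i mod L)) = \<infinity>"
      using in_N[OF w(1) i(1)] \<Delta>_edge[OF in_N[OF w(1) i(1)]]
      by (auto simp: cycle_edge_def observed_def edge_def min_def max_def split: if_splits)
    then have "\<Phi> $ q (w i) $ q (w (Suc i mod L)) = 0"
      by (simp add: \<Phi>_def reciprocal_nth[OF pos])
    with i(1) show ?thesis by (intro prod_zero) auto
  qed
  have "(\<Sum>w\<in>cycles L {1..N}. \<Prod>i<L. \<Phi> $ q (w i) $ q (w (Suc i mod L))) =
      (\<Sum>w\<in>W. \<Prod>i<L. \<Phi> $ q (w i) $ q (w (Suc i mod L)))"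
    using unobserved by (intro sum.mono_neutral_right finite_cycles) (auto simp: W_def)
  \<comment> \<open>The absolute values make the weight nonnegative on every edge set, as
    \<open>sum_cycles_le_sum_edge_sets\<close> demands; on observed edges they change
    nothing.\<close>
  also have "\<dots> = (\<Sum>w\<in>W. \<bar>\<Prod>e\<in>?e w. 1 / ?v e\<bar>)"
    by (intro sum.cong refl) (auto simp: W_def weight abs_prod \<Phi>_nonneg)
  also have "\<dots> \<le> 2 * real L * (\<Sum>E\<in>?e ` W. \<bar>\<Prod>e\<in>E. 1 / ?v e\<bar>)"
    unfolding W_def by (rule sum_cycles_le_sum_edge_sets[OF L(1)]) auto
  also have "(\<Sum>E\<in>?e ` W. \<bar>\<Prod>e\<in>E. 1 / ?v e\<bar>) = S"
    unfolding S_def using v by (intro sum.cong refl abs_of_nonneg prod_nonneg) (force simp: W_def less_imp_le)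
  finally have S_gt: "K * real N ^ L < 2 * real L * S" using sum by simp
  then have "0 < 2 * real L * S"
    using K by (intro order_le_less_trans[OF _ S_gt]) simp
  then have S_pos: "0 < S" using L by (simp add: zero_less_mult_iff)
  define \<mu> where "\<mu> = (\<beta> / sqrt (real N)) ^ L * t L"
  obtain C where C: "AE x in signal_law \<beta> \<nu> N. \<forall>e\<in>{1..N} \<times> {1..N}. \<bar>x e\<bar> \<le> C"
    using AE_signal_law_bounded[OF \<nu>] by blast
  then have bdd: "AE x in signal_law \<beta> \<nu> N. \<forall>e\<in>?J. \<bar>x e\<bar> \<le> C"
    by (rule eventually_mono) (use observed_subset in blast)
  have sets_signal: "sets (signal_law \<beta> \<nu> N) = sets (PiM ({1..N} \<times> {1..N}) (\<lambda>_. borel))"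
    by (simp add: signal_law_def)
  note planted = integral_planted_law_prod[OF prob_space_signal_law[OF \<nu>(1,2)] sets_signal bdd v]
  have "ereal (\<mu>\<^sup>2 * S - 1) \<le> chi2_lowdeg ?J D ?P (PiM ?J (\<lambda>e. gaussian 0 (?v e)))"
    unfolding S_def
  proof (rule chi2_lowdeg_squarefree_ge[OF finite_observed v])
    fix E assume "E \<in> ?e ` W"
    then obtain w where w: "w \<in> cycles L {1..N}" "?e w \<subseteq> ?J" "E = ?e w" by (auto simp: W_def)
    show "E \<subseteq> ?J \<and> card E \<le> D"
      using w L card_image_le[of "{..<L}" "cycle_edge L w"] by auto
    show "integrable ?P (\<lambda>y. \<Prod>e\<in>E. y e)"
      unfolding w(3) by (rule planted(1)[OF _ w(2)])
    show "(\<integral>y. (\<Prod>e\<in>E. y e) \<partial>?P) = \<mu>"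
      using planted(2)[OF _ w(2)] integral_signal_law_cycle[OF \<nu> L(1) w(1)]
      by (simp add: w(3) \<mu>_def t_def)
  next
    show "0 < (\<Sum>E\<in>?e ` W. \<Prod>e\<in>E. 1 / ?v e)" using S_pos by (simp only: S_def)
    show "\<mu> \<noteq> 0" using t \<beta> N by (simp add: \<mu>_def)
  qed
  also have "PiM ?J (\<lambda>e. gaussian 0 (?v e)) = null_law N \<Delta>"
    by (simp add: null_law_def gaussian_obs_eq)
  finally have ge: "ereal (\<mu>\<^sup>2 * S - 1) \<le> chi2_lowdeg ?J D ?P (null_law N \<Delta>)" .
  have "\<mu>\<^sup>2 = \<beta> ^ (2 * L) / real N ^ L * (t L)\<^sup>2"
  proof -
    have "((\<beta> / sqrt (real N)) ^ L)\<^sup>2 = ((\<beta> / sqrt (real N))\<^sup>2) ^ L"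
      by (simp only: power_mult[symmetric] mult.commute)
    also have "(\<beta> / sqrt (real N))\<^sup>2 = \<beta>\<^sup>2 / real N"
      by (simp add: power_divide)
    also have "(\<beta>\<^sup>2 / real N) ^ L = \<beta> ^ (2 * L) / real N ^ L"
      by (simp add: power_divide power_mult)
    finally show ?thesis
      unfolding \<mu>_def power_mult_distrib by (rule arg_cong)
  qed
  then have "\<beta> ^ (2 * L) * (t L)\<^sup>2 * (K / (2 * real L)) = \<mu>\<^sup>2 * (K * real N ^ L / (2 * real L))"
    using N by simp
  also have "\<dots> \<le> \<mu>\<^sup>2 * S"
    using S_gt L by (intro mult_left_mono) (auto simp: pos_divide_le_eq mult.commute)
  finally show ?thesis
    by (intro order_trans[OF _ ge]) simp
qed

lemma diag_conjugate_nth: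
  "(diag s ** A ** diag s) $ a $ b = s $ a * A $ a $ b * s $ b"
  by (simp add: matrix_matrix_mult_def diag_def if_distrib if_distribR sum.If_cases cong: if_cong)

text \<open>A finite threshold excludes \<Phi> = 0. Then \<open>T\<close> has nonnegative entries
  and a positive one, so the all-ones vector has a positive Rayleigh quotient and the top eigenvalue
  is positive. Squaring the threshold inequality gives
  \<open>1 < \<beta>\<^sup>2 * l\<close>.\<close>

lemma beta_star_less_imp:
  fixes \<Delta>bar :: "ereal ^ 'n ^ 'n" and \<rho> :: "real ^ 'n"
  defines "T \<equiv> diag (\<chi> a. sqrt (\<rho> $ a)) ** reciprocal \<Delta>bar ** diag (\<chi> a. sqrt (\<rho> $ a))"
  assumes pos: "\<And>a b. 0 < \<Delta>bar $ a $ b" and sym: "transpose \<Delta>bar = \<Delta>bar"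
    and \<rho>: "\<And>a. 0 < \<rho> $ a" and \<beta>: "0 < \<beta>" and less: "beta_star \<Delta>bar \<rho> < ereal \<beta>"
  obtains l v where "0 < l" "1 < \<beta>\<^sup>2 * l" "transpose T = T" "v \<noteq> 0" "T *v v = l *\<^sub>R v"
proof -
  let ?\<Phi> = "reciprocal \<Delta>bar"
  have sym': "\<Delta>bar $ a $ b = \<Delta>bar $ b $ a" for a b
    using sym unfolding transpose_def by (metis vec_lambda_beta)
  have T: "T $ a $ b = sqrt (\<rho> $ a) * ?\<Phi> $ a $ b * sqrt (\<rho> $ b)" for a b
    by (simp add: T_def diag_conjugate_nth)
  have T_sym: "transpose T = T"
    by (simp add: vec_eq_iff transpose_def T reciprocal_nth[OF pos] sym' mult_ac)
  have \<Phi>_nonneg: "0 \<le> ?\<Phi> $ a $ b" for a b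
    unfolding reciprocal_nth[OF pos] using pos[of a b] by (simp add: real_of_ereal_pos)
  have "?\<Phi> \<noteq> 0" using less by (auto simp: beta_star_def)
  then obtain a b where "?\<Phi> $ a $ b \<noteq> 0" by (auto simp: vec_eq_iff)
  with \<Phi>_nonneg[of a b] \<rho> have Tab: "0 < T $ a $ b" by (simp add: T)
  have T_nonneg: "0 \<le> T $ a $ b" for a b
    using \<Phi>_nonneg \<rho> by (simp add: T less_imp_le)
  obtain v where v: "v \<noteq> 0" "T *v v = lambda_max T *\<^sub>R v"
    and ray: "\<And>w. w \<bullet> (T *v w) \<le> lambda_max T * (w \<bullet> w)"
    using ex_eigenvector_lambda_max[OF T_sym] by blast
  have "0 < (\<Sum>i\<in>UNIV. \<Sum>j\<in>UNIV. T $ i $ j)"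
    using Tab T_nonneg by (intro sum_pos2[of _ a] sum_pos2[of _ b] sum_nonneg) auto
  also have "\<dots> = (\<chi> i. 1) \<bullet> (T *v (\<chi> i. 1))"
    by (simp add: inner_vec_def matrix_vector_mult_def)
  also have "\<dots> \<le> lambda_max T * ((\<chi> i. 1) \<bullet> ((\<chi> i. 1) :: real ^ 'n))" by (rule ray)
  finally have l: "0 < lambda_max T"
    by (simp add: zero_less_mult_iff not_less inner_ge_zero[THEN leD])
  have "sqrt (1 / lambda_max T) < \<beta>"
    using less \<open>?\<Phi> \<noteq> 0\<close> by (simp add: beta_star_def T_def Let_def)
  then have "(sqrt (1 / lambda_max T))\<^sup>2 < \<beta>\<^sup>2"
    using l by (intro power_strict_mono) auto
  then have "1 < \<beta>\<^sup>2 * lambda_max T"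
    using l by (simp add: pos_divide_less_eq)
  with l T_sym v that show ?thesis by blast
qed

section \<open>Choice of the cycle length and divergence\<close>

theorem theorem1p12:
  fixes \<Delta> :: "nat \<Rightarrow> nat \<Rightarrow> nat \<Rightarrow> ereal"
    and \<Delta>bar :: "ereal ^ 'n ^ 'n"
    and \<rho> :: "real ^ 'n"
    and \<nu> :: "(real ^ 'k) measure"
    and \<beta> :: real
    and D :: "nat \<Rightarrow> nat"
  assumes "block_structured \<Delta> \<Delta>bar \<rho>"
    and "prob_space \<nu>" and "sets \<nu> = sets borel"
    and "0 < \<beta>"
    and "mean \<nu> = 0"
    and "spectral_norm (cov \<nu>) = spectral_norm (second_moment \<nu>)"
    and "spectral_norm (second_moment \<nu>) = 1"
    and "bounded (support \<nu>)"
    and "beta_star \<Delta>bar \<rho> < ereal \<beta>"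
    and "filterlim D at_top sequentially"
  shows "((\<lambda>N. chi2_lowdeg (observed N (\<Delta> N)) (D N)
             (planted_law N (\<Delta> N) (signal_law \<beta> \<nu> N)) (null_law N (\<Delta> N)))
           \<longlongrightarrow> \<infinity>) sequentially"
  unfolding tendsto_PInfty
proof
  fix M :: real
  note \<nu> = assms(2,3,8)
  have \<rho>: "0 < \<rho> $ a" and pos: "0 < \<Delta>bar $ a $ b" and sym: "transpose \<Delta>bar = \<Delta>bar" for a b
    using assms(1) by (simp_all add: block_structured_def)
  obtain q where \<Delta>: "\<forall>N\<ge>1. \<forall>i\<in>{1..N}. \<forall>j\<in>{1..N}. \<Delta> N i j = \<Delta>bar $ q N i $ q N j"
    and lim: "\<forall>a. (\<lambda>N. real (card {i \<in> {1..N}. q N i = a}) / real N) \<longlonglongrightarrow> \<rho> $ a"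
    using assms(1) unfolding block_structured_def by blast
  define T where "T = diag (\<chi> a. sqrt (\<rho> $ a)) ** reciprocal \<Delta>bar ** diag (\<chi> a. sqrt (\<rho> $ a))"
  obtain l v where l: "0 < l" "1 < \<beta>\<^sup>2 * l" and T: "transpose T = T" "v \<noteq> 0" "T *v v = l *\<^sub>R v"
    unfolding T_def using beta_star_less_imp[OF pos sym \<rho> assms(4,9)] by blast
  \<comment> \<open>A vector stretched by at least \<open>r\<close> is available for every
    \<open>r\<close> below the spectral norm 1. The strict inequality
    \<open>1 < \<beta>\<^sup>2 * l\<close> leaves room for the resulting loss of
    \<open>r\<^sup>2\<close> per edge.\<close>
  obtain r where r: "0 < r" "r < 1" "1 < \<beta>\<^sup>2 * l * r\<^sup>2"
  proof -
    have y: "1 / (\<beta>\<^sup>2 * l) < 1" "0 < 1 / (\<beta>\<^sup>2 * l)" using l by (simp_all add: pos_divide_less_eq)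
    obtain s where s: "1 / (\<beta>\<^sup>2 * l) < s" "s < 1" using dense[OF y(1)] by blast
    have s0: "0 < s" using y(2) s(1) by (rule less_trans)
    have "1 < \<beta>\<^sup>2 * l * s" using s(1) l by (simp add: pos_divide_less_eq mult.commute)
    then show ?thesis using s(2) s0 by (intro that[of "sqrt s"]) auto
  qed
  define x where "x = \<beta>\<^sup>2 * l * r\<^sup>2"
  have "1 < x" using r(3) by (simp add: x_def)
  \<comment> \<open>With \<open>L = 2 * m\<close> the denominator is \<open>4 * L\<close>: a factor
    \<open>2 * L\<close> from the marked cycles and 2 from halving in \<open>K\<close>. The extra 1
    added to \<open>M\<close> below pays for the subtraction in the divergence.\<close>
  then have "filterlim (\<lambda>m. x ^ (2 * m) / (8 * real m)) at_top sequentially"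
    by real_asymp
  then have "\<forall>\<^sub>F m in sequentially. M + 1 < x ^ (2 * m) / (8 * real m)"
    by (simp add: filterlim_at_top_dense)
  then have "\<forall>\<^sub>F m in sequentially. M + 1 < x ^ (2 * m) / (8 * real m) \<and> 2 \<le> m"
    using eventually_ge_at_top[of 2] by (rule eventually_conj)
  then obtain m where m: "M + 1 < x ^ (2 * m) / (8 * real m)" "2 \<le> m"
    using eventually_happens by (metis (no_types, lifting) trivial_limit_sequentially)
  define L where "L = 2 * m"
  have L: "3 \<le> L" using m by (simp add: L_def)
  let ?\<Sigma> = "second_moment \<nu>"
  define t where "t = cycle_sum L (\<lambda>a b. ?\<Sigma> $ a $ b) UNIV"
  obtain u where u: "u \<noteq> 0" "r * norm u \<le> norm (?\<Sigma> *v u)"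
    using ex_norm_matrix_vector_mult_ge[of r ?\<Sigma>] r(2) assms(7) by metis
  have t: "r ^ L \<le> t"
    unfolding t_def L_def using r m
    by (intro cycle_sum_even_ge[OF transpose_second_moment[OF \<nu>] _ u]) auto
  \<comment> \<open>Halving gives the strict inequality below the limit that makes the cycle bound
    hold eventually.\<close>
  define K where "K = l ^ L / 2"
  have K_nonneg: "0 \<le> K" using l(1) by (simp add: K_def)
  have "l ^ L \<le> cycle_sum L (\<lambda>a b. T $ a $ b) UNIV"
    unfolding L_def using l m T(3) by (intro cycle_sum_even_ge[OF T(1) _ T(2)]) auto
  then have "K < cycle_sum L (\<lambda>a b. T $ a $ b) UNIV"
    using zero_less_power[OF l(1), of L] unfolding K_def by linarith
  then have K: "K < cycle_sum L (\<lambda>a b. sqrt (\<rho> $ a) * reciprocal \<Delta>bar $ a $ b * sqrt (\<rho> $ b)) UNIV"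
    by (simp add: T_def diag_conjugate_nth)
  have "\<forall>\<^sub>F N in sequentially. K * real N ^ L <
      (\<Sum>w\<in>cycles L {1..N}. \<Prod>i<L. reciprocal \<Delta>bar $ q N (w i) $ q N (w (Suc i mod L)))"
    using \<rho> L pos by (intro eventually_sum_cycles_blocks_gt[OF _ spec[OF lim] _ _ K])
      (auto simp: reciprocal_nth less_imp_le real_of_ereal_pos)
  \<comment> \<open>The length \<open>L\<close> depends on \<open>M\<close> but not on
    \<open>N\<close>, so the growing degree bound eventually admits the cycle polynomial.\<close>
  moreover have "\<forall>\<^sub>F N in sequentially. L \<le> D N"
    using assms(10) by (simp add: filterlim_at_top)
  ultimately show "\<forall>\<^sub>F N in sequentially. ereal M < chi2_lowdeg (observed N (\<Delta> N)) (D N)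
      (planted_law N (\<Delta> N) (signal_law \<beta> \<nu> N)) (null_law N (\<Delta> N))"
    using eventually_gt_at_top[of 0]
  proof eventually_elim
    case (elim N)
    have "x ^ L / (4 * real L) = \<beta> ^ (2 * L) * (r ^ L)\<^sup>2 * (K / (2 * real L))"
      by (simp add: x_def K_def power_mult_distrib power_mult[symmetric] mult.commute)
    also have "\<dots> \<le> \<beta> ^ (2 * L) * t\<^sup>2 * (K / (2 * real L))"
      using t r(1) l assms(4)
      by (intro mult_right_mono mult_left_mono power_mono) (auto simp: K_def)
    finally have "M < \<beta> ^ (2 * L) * t\<^sup>2 * (K / (2 * real L)) - 1"
      using m(1) by (simp add: L_def)
    moreover have "t \<noteq> 0" using t zero_less_power[OF r(1), of L] by linarith
    then have "ereal (\<beta> ^ (2 * L) * t\<^sup>2 * (K / (2 * real L)) - 1) \<le>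
        chi2_lowdeg (observed N (\<Delta> N)) (D N) (planted_law N (\<Delta> N) (signal_law \<beta> \<nu> N)) (null_law N (\<Delta> N))"
      unfolding t_def using elim L assms(4) K_nonneg
      by (intro chi2_lowdeg_block_ge[OF \<nu> _ pos sym, where q = "q N"]) (auto simp: \<Delta>)
    ultimately show ?case
      by (meson less_ereal.simps(1) order_less_le_trans)
  qed
qed

end
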